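(* Let $\mu$ be a generating probability measure on a discrete group $\Gamma$, let $\tau$ be a bounded randomized stopping time for the random walk $(\Gamma,\mu)$, and let $0<t\le 1$. Put $\mu_{\tau,t}=t\mu+(1-t)\mu_\tau$. Then $H^+(\Gamma,\mu)=H^+(\Gamma,\mu_{\tau,t})$.
   Context: A probability measure $\mu$ on $\Gamma$ is generating if the semigroup generated by its support is all of $\Gamma$. The random walk $(\Gamma,\mu)$ started at the identity $e$ has sample paths $\boldsymbol{x}=(x_0,x_1,x_2,\dots)$ with $x_0=e$, $x_n=h_1\cdots h_n$, where $h_1,h_2,\dots$ are independent and $\mu$-distributed; $\mathbf{P}$ denotes the law of $\boldsymbol{x}$ on $\Gamma^{\mathbb{Z}_+}:=\{e\}\times\Gamma^{\mathbb{N}}$. A stopping time is a measurable map $\tau:\Gamma^{\mathbb{Z}_+}\to\{1,2,\dots\}\cup\{\infty\}$ such that for each integer $s\ge1$ the set $\tau^{-1}(s)$ belongs to the $\sigma$-algebra generated by $x_0,\dots,x_s$. Given an auxiliary probability space $(\Omega,\lambda)$, a randomized stopping time is a measurable map $\tau:\Gamma^{\mathbb{Z}_+}\times\Omega\to\{1,2,\dots\}\cup\{\infty\}$ such that $\tau(\cdot,\omega)$ is a stopping time for every $\omega\in\Omega$. It is bounded if there is an integer $M$ with $\tau\le M$. The transformed measure is $\mu_\tau(g)=(\mathbf{P}\otimes\lambda)\{(\boldsymbol{x},\omega): x_{\tau(\boldsymbol{x},\omega)}=g\}$. For a probability measure $\theta$ on $\Gamma$, a function $f:\Gamma\to\mathbb{R}$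 is $\theta$-harmonic if for every $g\in\Gamma$ the series $\sum_{h\in\Gamma}f(gh)\theta(h)$ converges absolutely with sum $f(g)$. $H^+(\Gamma,\theta)$ is the set of positive $\theta$-harmonic functions, where positive means nonnegative. *)

theory Defs
  imports "HOL-Probability.Probability" "HOL-Algebra.Group"
begin

inductive_set semigroup_span :: "('a, 'b) monoid_scheme \<Rightarrow> 'a set \<Rightarrow> 'a set"
  for G (structure) and S where
  incl: "g \<in> S \<Longrightarrow> g \<in> semigroup_span G S"
| mult: "g \<in> semigroup_span G S \<Longrightarrow> h \<in> semigroup_span G S \<Longrightarrow> g \<otimes> h \<in> semigroup_span G S"

text \<open>Since a \<open>pmf\<close> has countable support, the existence of a generating measure forces the group
  to be countable, so that all maps below are measurable for the product \<open>\<sigma>\<close>-algebras.\<close>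

definition generating :: "('a, 'b) monoid_scheme \<Rightarrow> 'a pmf \<Rightarrow> bool" where
  "generating G \<mu> \<longleftrightarrow> semigroup_span G (set_pmf \<mu>) = carrier G"

definition path_space :: "('a, 'b) monoid_scheme \<Rightarrow> (nat \<Rightarrow> 'a) measure" where
  "path_space G =
     Pi\<^sub>M UNIV (\<lambda>n. count_space (if n = 0 then {\<one>\<^bsub>G\<^esub>} else carrier G))"

text \<open>The increments are indexed from 0, so \<open>h n\<close> is the step from time \<open>n\<close> to time \<open>n + 1\<close>.\<close>

primrec walk :: "('a, 'b) monoid_scheme \<Rightarrow> (nat \<Rightarrow> 'a) \<Rightarrow> nat \<Rightarrow> 'a" where
  "walk G h 0 = \<one>\<^bsub>G\<^esub>"
| "walk G h (Suc n) = walk G h n \<otimes>\<^bsub>G\<^esub> h n"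

text \<open>A \<open>pmf\<close> lives on the whole type; restricting it to the carrier loses no mass when
  its support lies in the carrier.\<close>

definition walk_law :: "('a, 'b) monoid_scheme \<Rightarrow> 'a pmf \<Rightarrow> (nat \<Rightarrow> 'a) measure" where
  "walk_law G \<mu> =
     distr (Pi\<^sub>M UNIV (\<lambda>_. restrict_space (measure_pmf \<mu>) (carrier G))) (path_space G) (walk G)"

definition path_history :: "('a, 'b) monoid_scheme \<Rightarrow> nat \<Rightarrow> (nat \<Rightarrow> 'a) set set" where
  "path_history G s =
     sigma_sets (space (path_space G))
       {{x \<in> space (path_space G). x i \<in> A} | i A. i \<le> s \<and> A \<subseteq> carrier G}"

text \<open>The set \<open>{1..}\<close> of extended naturals contains \<open>\<infinity>\<close>.\<close>

definition path_stopping_time ::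
    "('a, 'b) monoid_scheme \<Rightarrow> ((nat \<Rightarrow> 'a) \<Rightarrow> enat) \<Rightarrow> bool" where
  "path_stopping_time G \<tau> \<longleftrightarrow>
     \<tau> \<in> path_space G \<rightarrow>\<^sub>M count_space {1..} \<and>
     (\<forall>s\<ge>1. {x \<in> space (path_space G). \<tau> x = enat s} \<in> path_history G s)"

definition randomized_stopping_time ::
    "('a, 'b) monoid_scheme \<Rightarrow> 'w measure \<Rightarrow> ((nat \<Rightarrow> 'a) \<times> 'w \<Rightarrow> enat) \<Rightarrow> bool" where
  "randomized_stopping_time G \<Lambda> \<tau> \<longleftrightarrow>
     \<tau> \<in> path_space G \<Otimes>\<^sub>M \<Lambda> \<rightarrow>\<^sub>M count_space {1..} \<and>
     (\<forall>\<omega>\<in>space \<Lambda>. path_stopping_time G (\<lambda>x. \<tau> (x, \<omega>)))"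

definition bounded_stopping_time ::
    "('a, 'b) monoid_scheme \<Rightarrow> 'w measure \<Rightarrow> ((nat \<Rightarrow> 'a) \<times> 'w \<Rightarrow> enat) \<Rightarrow> bool" where
  "bounded_stopping_time G \<Lambda> \<tau> \<longleftrightarrow>
     (\<exists>M::nat. \<forall>z \<in> space (path_space G \<Otimes>\<^sub>M \<Lambda>). \<tau> z \<le> enat M)"

text \<open>Probability measures on the discrete group are identified with their mass functions from here
  on. Paths with \<open>\<tau> = \<infinity>\<close> contribute no mass.\<close>

definition transformed_mass ::
    "('a, 'b) monoid_scheme \<Rightarrow> 'a pmf \<Rightarrow> 'w measure \<Rightarrow> ((nat \<Rightarrow> 'a) \<times> 'w \<Rightarrow> enat) \<Rightarrow> 'a \<Rightarrow> real" where
  "transformed_mass G \<mu> \<Lambda> \<tau> g =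
     measure (walk_law G \<mu> \<Otimes>\<^sub>M \<Lambda>)
       {(x, \<omega>) \<in> space (walk_law G \<mu> \<Otimes>\<^sub>M \<Lambda>). \<exists>n. \<tau> (x, \<omega>) = enat n \<and> x n = g}"

definition harmonic :: "('a, 'b) monoid_scheme \<Rightarrow> ('a \<Rightarrow> real) \<Rightarrow> ('a \<Rightarrow> real) \<Rightarrow> bool" where
  "harmonic G \<theta> f \<longleftrightarrow>
     (\<forall>g\<in>carrier G.
        (\<lambda>h. \<bar>f (g \<otimes>\<^bsub>G\<^esub> h) * \<theta> h\<bar>) summable_on carrier G \<and>
        ((\<lambda>h. f (g \<otimes>\<^bsub>G\<^esub> h) * \<theta> h) has_sum f g) (carrier G))"

definition positive_harmonic :: "('a, 'b) monoid_scheme \<Rightarrow> ('a \<Rightarrow> real) \<Rightarrow> ('a \<Rightarrow> real) set" where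
  "positive_harmonic G \<theta> = {f \<in> carrier G \<rightarrow>\<^sub>E {0..}. harmonic G \<theta> f}"

end

theory Submission imports Defs begin

text \<open>Let \<open>P\<close> be the operator of the walk, let \<open>\<sigma>\<close> be the randomized stopping time which equals 1 with
  probability \<open>t\<close> and \<open>\<tau>\<close> otherwise, and suppose that \<open>\<sigma> \<le> M\<close>. Positive \<open>P\<close>-harmonic functions are
  harmonic for the stopped walk by optional stopping. Conversely, let \<open>f \<ge> 0\<close> satisfy
  \<open>f g = E (f (g x\<^sub>\<sigma>))\<close>, and iterate \<open>\<sigma>\<close> along a fixed path to obtain renewal times. Since every
  renewal is followed by another one at the next time with probability at least \<open>t\<close>, whatever the
  path, a renewal occurs at any given time \<open>n\<close> with probability at least \<open>t ^ M\<close>, whence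
  \<open>P ^ n f \<le> t ^ -M f\<close>. By the same token the law of the first renewal time after \<open>n\<close> hardly
  depends on whether the renewals start at time 0 or at time 1: the weights differ by an
  exponentially small amount, uniformly in the path. Stopping there represents \<open>f\<close> and \<open>P f\<close>,
  respectively, so that \<open>\<bar>f - P f\<bar>\<close> is bounded by a null sequence times \<open>f\<close>.\<close>

section \<open>Backward averaging recursions\<close>

text \<open>\<open>Q i j\<close> is the probability of a jump from \<open>i\<close> to
  \<open>i + Suc j\<close> in a time-inhomogeneous chain, and \<open>\<phi>\<close> is harmonic for
  this chain below \<open>n\<close>. Jumps have length at most \<open>M\<close>, so the values on
  the window from \<open>n\<close> to \<open>n + M - 1\<close> act as boundary data.\<close>

definition forward_average :: "nat \<Rightarrow> (nat \<Rightarrow> nat \<Rightarrow> real) \<Rightarrow> (nat \<Rightarrow> real) \<Rightarrow> nat \<Rightarrow> bool" where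
  "forward_average M Q \<phi> n \<longleftrightarrow>
     (\<forall>i<n. (\<forall>j<M. 0 \<le> Q i j) \<and> (\<Sum>j<M. Q i j) = 1 \<and> \<phi> i = (\<Sum>j<M. Q i j * \<phi> (i + Suc j)))"

text \<open>No jump is longer than \<open>M\<close>, so a chain started below \<open>s\<close>
  visits a position at distance at most \<open>M\<close> below \<open>s\<close>. From there unit
  jumps alone lead to \<open>s\<close> with probability at least \<open>t ^ M\<close>. This much
  mass sees the value \<open>\<phi> s\<close>, the rest at most \<open>b\<close>.\<close>

lemma forward_average_upper:
  assumes avg: "forward_average M Q \<phi> s"
    and t: "0 \<le> t" "\<And>i. i < s \<Longrightarrow> t \<le> Q i 0"
    and M: "0 < M"
    and b: "\<And>i. s \<le> i \<Longrightarrow> i < s + M \<Longrightarrow> \<phi> i \<le> b"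
    and i: "i < s"
  shows "\<phi> i \<le> b - t ^ M * (b - \<phi> s)"
proof -
  have \<phi>s: "\<phi> s \<le> b" using b M by simp
  have t1: "t \<le> 1"
  proof -
    have "t \<le> Q i 0" using t i by blast
    also have "\<dots> \<le> (\<Sum>j<M. Q i j)"
      using avg i M by (intro member_le_sum) (auto simp: forward_average_def)
    also have "\<dots> = 1" using avg i by (auto simp: forward_average_def)
    finally show ?thesis .
  qed
  have avg_le: "\<phi> k \<le> c" if k: "k < s" and c: "\<And>j. j < M \<Longrightarrow> \<phi> (k + Suc j) \<le> c" for k c
  proof -
    have "\<phi> k = (\<Sum>j<M. Q k j * \<phi> (k + Suc j))" using avg k by (auto simp: forward_average_def)
    also have "\<dots> \<le> (\<Sum>j<M. Q k j * c)"
      using avg k c by (intro sum_mono mult_left_mono) (auto simp: forward_average_def)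
    also have "\<dots> = c" using avg k by (auto simp: forward_average_def sum_distrib_right[symmetric])
    finally show ?thesis .
  qed
  \<comment> \<open>Written as \<open>b\<close> minus an average of deficits, all of them
    nonnegative; only the deficit of the unit jump is kept.\<close>
  have first: "\<phi> k \<le> b - Q k 0 * (b - \<phi> (Suc k))"
    if k: "k < s" and c: "\<And>j. j < M \<Longrightarrow> \<phi> (k + Suc j) \<le> b" for k
  proof -
    have Q: "Q k j \<ge> 0" if "j < M" for j using avg k that by (auto simp: forward_average_def)
    have "\<phi> k = (\<Sum>j<M. Q k j * \<phi> (k + Suc j))" using avg k by (auto simp: forward_average_def)
    also have "\<dots> = (\<Sum>j<M. Q k j * b) - (\<Sum>j<M. Q k j * (b - \<phi> (k + Suc j)))"
      by (simp add: sum_subtractf[symmetric] algebra_simps)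
    also have "(\<Sum>j<M. Q k j * b) = b"
      using avg k by (auto simp: forward_average_def sum_distrib_right[symmetric])
    finally have eq: "\<phi> k = b - (\<Sum>j<M. Q k j * (b - \<phi> (k + Suc j)))" .
    have "Q k 0 * (b - \<phi> (k + Suc 0)) \<le> (\<Sum>j<M. Q k j * (b - \<phi> (k + Suc j)))"
      using M Q c by (intro member_le_sum[of 0]) auto
    then show ?thesis unfolding eq by simp
  qed
  \<comment> \<open>\<open>d\<close> is the distance to \<open>s\<close>. Up to distance
    \<open>M\<close>, a run of \<open>d\<close> unit jumps gives the exponent \<open>d\<close>; from
    farther away every jump still lands below \<open>s\<close>, where the exponent is at most
    \<open>M\<close> by induction.\<close>
  have "\<phi> (s - d) \<le> b - t ^ min d M * (b - \<phi> s)" if "d \<le> s" for d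
    using that
  proof (induction d rule: less_induct)
    case (less d)
    have IHb: "\<phi> (s - e) \<le> b" if "e < d" for e
    proof -
      have "0 \<le> t ^ min e M * (b - \<phi> s)" using \<phi>s t by simp
      then show ?thesis using less.IH[OF that] less.prems that by simp
    qed
    have window: "\<phi> (s - d + Suc j) \<le> b" if "j < M" "0 < d" for j
    proof (cases "Suc j \<le> d")
      case True
      then have eq: "s - d + Suc j = s - (d - Suc j)" using less.prems by simp
      show ?thesis unfolding eq by (rule IHb) (use that in simp)
    next
      case False
      then show ?thesis using less.prems that by (intro b) auto
    qed
    consider "d = 0" | "0 < d" "d \<le> M" | "d > M" by linarith
    then show ?case
    proof cases
      case 1
      then show ?thesis by simp
    next
      case 2
      then have lt: "s - d < s" using less.prems by simp
      have S: "Suc (s - d) = s - (d - 1)" using 2 less.prems by simp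
      have IH: "\<phi> (Suc (s - d)) \<le> b - t ^ (d - 1) * (b - \<phi> s)"
      proof -
        have "min (d - 1) M = d - 1" using 2 by simp
        then show ?thesis unfolding S using less.IH[of "d - 1"] less.prems 2 by simp
      qed
      have "\<phi> (s - d) \<le> b - Q (s - d) 0 * (b - \<phi> (Suc (s - d)))"
        by (intro first[OF lt] window) (use 2 in auto)
      moreover have "t * (t ^ (d - 1) * (b - \<phi> s)) \<le> Q (s - d) 0 * (b - \<phi> (Suc (s - d)))"
      proof (intro mult_mono)
        show "t \<le> Q (s - d) 0" by (rule t(2)[OF lt])
        with t(1) show "0 \<le> Q (s - d) 0" by linarith
        show "t ^ (d - 1) * (b - \<phi> s) \<le> b - \<phi> (Suc (s - d))" using IH by linarith
        show "0 \<le> t ^ (d - 1) * (b - \<phi> s)" using t(1) \<phi>s by simp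
      qed
      moreover have "t * (t ^ (d - 1) * (b - \<phi> s)) = t ^ d * (b - \<phi> s)"
        using 2 by (cases d) auto
      ultimately show ?thesis unfolding min_absorb1[OF 2(2)] by linarith
    next
      case 3
      have next_le: "\<phi> (s - d + Suc j) \<le> b - t ^ M * (b - \<phi> s)" if "j < M" for j
      proof -
        have eq: "s - d + Suc j = s - (d - Suc j)" using less.prems that 3 by simp
        have "\<phi> (s - d + Suc j) \<le> b - t ^ min (d - Suc j) M * (b - \<phi> s)"
          unfolding eq by (rule less.IH) (use less.prems that 3 in simp_all)
        moreover have "t ^ M * (b - \<phi> s) \<le> t ^ min (d - Suc j) M * (b - \<phi> s)"
          using t t1 \<phi>s by (intro mult_right_mono power_decreasing) auto
        ultimately show ?thesis by linarith
      qed
      have "\<phi> (s - d) \<le> b - t ^ M * (b - \<phi> s)"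
        by (rule avg_le[OF _ next_le]) (use 3 less.prems in simp_all)
      moreover have "min d M = M" using 3 by simp
      ultimately show ?thesis by simp
    qed
  qed
  from this[of "s - i"] have "\<phi> i \<le> b - t ^ min (s - i) M * (b - \<phi> s)" using i by simp
  moreover have "t ^ M * (b - \<phi> s) \<le> t ^ min (s - i) M * (b - \<phi> s)"
    using t t1 \<phi>s by (intro mult_right_mono power_decreasing) auto
  ultimately show ?thesis by linarith
qed

lemma forward_average_uminus:
  "forward_average M Q \<phi> s \<Longrightarrow> forward_average M Q (\<lambda>i. - \<phi> i) s"
  by (auto simp: forward_average_def sum_negf)

lemma forward_average_antimono:
  "forward_average M Q \<phi> n \<Longrightarrow> s \<le> n \<Longrightarrow> forward_average M Q \<phi> s"
  by (auto simp: forward_average_def)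

lemma forward_average_lower:
  assumes "forward_average M Q \<phi> s"
    and "0 \<le> t" "\<And>i. i < s \<Longrightarrow> t \<le> Q i 0"
    and "0 < M"
    and "\<And>i. s \<le> i \<Longrightarrow> i < s + M \<Longrightarrow> a \<le> \<phi> i"
    and "i < s"
  shows "a + t ^ M * (\<phi> s - a) \<le> \<phi> i"
  using forward_average_upper[OF forward_average_uminus[OF assms(1)] assms(2-4), of "- a" i] assms(5,6)
  by (simp add: algebra_simps)

text \<open>Doeblin contraction: one step back over a full window shrinks the oscillation by the
  factor \<open>1 - t ^ M\<close>.\<close>

lemma forward_average_contraction:
  assumes avg: "forward_average M Q \<phi> n"
    and t: "0 \<le> t" "\<And>i. i < n \<Longrightarrow> t \<le> Q i 0"
    and M: "0 < M"
    and base: "\<And>i. i < n + M \<Longrightarrow> 0 \<le> \<phi> i \<and> \<phi> i \<le> 1"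
    and m: "m * M \<le> n"
  shows "\<exists>a. \<forall>i < n - m * M + M. a \<le> \<phi> i \<and> \<phi> i \<le> a + (1 - t ^ M) ^ m"
  using m
proof (induction m)
  case 0
  show ?case using base by (intro exI[of _ 0]) auto
next
  case (Suc m)
  \<comment> \<open>The bounds known so far cover the window of length \<open>M\<close> that starts
    at \<open>s\<close>; it serves as boundary data for the indices below \<open>s\<close>.\<close>
  define s where "s = n - m * M"
  have s: "s \<le> n" "n - Suc m * M + M = s" using Suc.prems by (auto simp: s_def)
  from Suc obtain a where a: "\<And>i. i < s + M \<Longrightarrow> a \<le> \<phi> i \<and> \<phi> i \<le> a + (1 - t ^ M) ^ m"
    unfolding s_def by auto
  have avg': "forward_average M Q \<phi> s" and t': "\<And>i. i < s \<Longrightarrow> t \<le> Q i 0"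
    using forward_average_antimono[OF avg s(1)] t(2) s(1) by auto
  \<comment> \<open>Each bound moves towards the common value \<open>\<phi> s\<close> by the
    proportion \<open>t ^ M\<close> of its distance to it, so their gap shrinks by the factor
    \<open>1 - t ^ M\<close>.\<close>
  have "a + t ^ M * (\<phi> s - a) \<le> \<phi> i \<and> \<phi> i \<le> (a + t ^ M * (\<phi> s - a)) + (1 - t ^ M) ^ Suc m"
    if "i < s" for i
  proof -
    have "a + t ^ M * (\<phi> s - a) \<le> \<phi> i"
      using a that by (intro forward_average_lower[OF avg' t(1) t' M]) auto
    moreover have "\<phi> i \<le> a + (1 - t ^ M) ^ m - t ^ M * (a + (1 - t ^ M) ^ m - \<phi> s)"
      using a that by (intro forward_average_upper[OF avg' t(1) t' M]) auto
    ultimately show ?thesis by (simp add: algebra_simps)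
  qed
  then show ?case unfolding s(2) by blast
qed

section \<open>Stopping rules on lists of increments\<close>

lemma nn_integral_replicate_pmf_0: "(\<integral>\<^sup>+l. f l \<partial>replicate_pmf 0 p) = f []"
  by (simp add: nn_integral_return)

lemma nn_integral_replicate_pmf_add:
  "(\<integral>\<^sup>+l. f l \<partial>replicate_pmf (m + n) p) =
     (\<integral>\<^sup>+xs. \<integral>\<^sup>+ys. f (xs @ ys) \<partial>replicate_pmf n p \<partial>replicate_pmf m p)"
  by (simp add: replicate_pmf_distrib nn_integral_bind_pmf)

lemma nn_integral_replicate_pmf_Suc:
  "(\<integral>\<^sup>+l. f l \<partial>replicate_pmf (Suc n) p) = (\<integral>\<^sup>+x. \<integral>\<^sup>+xs. f (x # xs) \<partial>replicate_pmf n p \<partial>p)"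
  by (simp add: nn_integral_bind_pmf)

lemma nn_integral_pmf_cong:
  "(\<And>x. x \<in> set_pmf p \<Longrightarrow> f x = g x) \<Longrightarrow> (\<integral>\<^sup>+x. f x \<partial>measure_pmf p) = (\<integral>\<^sup>+x. g x \<partial>measure_pmf p)"
  by (intro nn_integral_cong_AE) (auto simp: AE_measure_pmf_iff)

lemma nn_integral_pmf_mono:
  "(\<And>x. x \<in> set_pmf p \<Longrightarrow> f x \<le> g x) \<Longrightarrow> (\<integral>\<^sup>+x. f x \<partial>measure_pmf p) \<le> (\<integral>\<^sup>+x. g x \<partial>measure_pmf p)"
  by (intro nn_integral_mono_AE) (auto simp: AE_measure_pmf_iff)

lemma in_set_replicate_pmf:
  "l \<in> set_pmf (replicate_pmf n p) \<longleftrightarrow> set l \<subseteq> set_pmf p \<and> length l = n"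
  by (auto simp: set_replicate_pmf)

text \<open>\<open>q l\<close> stands for the conditional probability, given increments beginning
  with \<open>l\<close>, that the rule stops at time \<open>length l\<close>. In this form a
  randomized stopping time bounded by \<open>M\<close> involves finite lists only, and
  \<open>q_sum\<close> says that it stops between times 1 and \<open>M\<close> on every
  path.\<close>

locale stopped_walk =
  fixes \<mu> :: "'a pmf" and act :: "'s \<Rightarrow> 'a \<Rightarrow> 's" and S :: "'s set"
    and M :: nat and q :: "'a list \<Rightarrow> real"
  assumes act_closed: "s \<in> S \<Longrightarrow> a \<in> set_pmf \<mu> \<Longrightarrow> act s a \<in> S"
    and M_pos: "0 < M"
    and q_nonneg: "0 \<le> q l"
    and q_sum: "set l \<subseteq> set_pmf \<mu> \<Longrightarrow> length l = M \<Longrightarrow> (\<Sum>i<M. q (take (Suc i) l)) = 1"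
begin

abbreviation paths :: "nat \<Rightarrow> 'a list pmf" where
  "paths n \<equiv> replicate_pmf n \<mu>"

text \<open>The expectation of \<open>F\<close> at the stopped position of the walk from
  \<open>s\<close>. With values in \<open>ennreal\<close>, sums and integrals can be exchanged
  without integrability conditions.\<close>

definition stopped :: "('s \<Rightarrow> ennreal) \<Rightarrow> 's \<Rightarrow> ennreal" where
  "stopped F s = (\<Sum>i<M. \<integral>\<^sup>+l. ennreal (q l) * F (foldl act s l) \<partial>paths (Suc i))"

lemma foldl_closed: "s \<in> S \<Longrightarrow> set l \<subseteq> set_pmf \<mu> \<Longrightarrow> foldl act s l \<in> S"
  by (induction l arbitrary: s) (auto intro: act_closed)

section \<open>Optional stopping\<close>

lemma harmonic_paths:
  assumes "\<And>s. s \<in> S \<Longrightarrow> (\<integral>\<^sup>+a. F (act s a) \<partial>\<mu>) = F s" and "s \<in> S"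
  shows "(\<integral>\<^sup>+l. F (foldl act s l) \<partial>paths n) = F s"
  using assms(2)
proof (induction n arbitrary: s)
  case 0
  then show ?case by (simp add: nn_integral_replicate_pmf_0 del: replicate_pmf.simps)
next
  case (Suc n)
  have "(\<integral>\<^sup>+l. F (foldl act s l) \<partial>paths (Suc n)) = (\<integral>\<^sup>+a. F (act s a) \<partial>\<mu>)"
    unfolding nn_integral_replicate_pmf_Suc foldl_Cons
    by (intro nn_integral_pmf_cong Suc.IH act_closed Suc.prems)
  then show ?case using assms(1)[OF Suc.prems] by simp
qed

text \<open>Harmonicity allows each stopped prefix to be continued to a path of length
  \<open>M\<close> without changing the expectation. On paths of this common length the weights of
  the prefixes add up to 1.\<close>

theorem stopped_eq_if_harmonic:
  assumes F: "\<And>s. s \<in> S \<Longrightarrow> (\<integral>\<^sup>+a. F (act s a) \<partial>\<mu>) = F s" and s: "s \<in> S"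
  shows "stopped F s = F s"
proof -
  have "(\<integral>\<^sup>+l. ennreal (q l) * F (foldl act s l) \<partial>paths (Suc i)) =
        (\<integral>\<^sup>+l. ennreal (q (take (Suc i) l)) * F (foldl act s l) \<partial>paths M)" if i: "i < M" for i
  proof -
    have M: "M = Suc i + (M - Suc i)" using i by simp
    have "(\<integral>\<^sup>+l. ennreal (q (take (Suc i) l)) * F (foldl act s l) \<partial>paths M) =
      (\<integral>\<^sup>+xs. \<integral>\<^sup>+ys. ennreal (q xs) * F (foldl act (foldl act s xs) ys)
         \<partial>paths (M - Suc i) \<partial>paths (Suc i))"
      by (subst M, subst nn_integral_replicate_pmf_add)
        (intro nn_integral_pmf_cong, simp add: in_set_replicate_pmf del: replicate_pmf.simps)
    also have "\<dots> = (\<integral>\<^sup>+xs. ennreal (q xs) * F (foldl act s xs) \<partial>paths (Suc i))"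
      by (intro nn_integral_pmf_cong)
        (simp add: nn_integral_cmult harmonic_paths[OF F] foldl_closed s in_set_replicate_pmf
          del: replicate_pmf.simps)
    finally show ?thesis by simp
  qed
  then have "stopped F s = (\<Sum>i<M. \<integral>\<^sup>+l. ennreal (q (take (Suc i) l)) * F (foldl act s l) \<partial>paths M)"
    unfolding stopped_def by (intro sum.cong) auto
  also have "\<dots> = (\<integral>\<^sup>+l. (\<Sum>i<M. ennreal (q (take (Suc i) l)) * F (foldl act s l)) \<partial>paths M)"
    by (simp add: nn_integral_sum)
  also have "\<dots> = (\<integral>\<^sup>+l. F (foldl act s l) \<partial>paths M)"
    by (intro nn_integral_pmf_cong)
      (simp add: in_set_replicate_pmf sum_distrib_right[symmetric] sum_ennreal q_nonneg q_sum)
  also have "\<dots> = F s" by (rule harmonic_paths[OF F s])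
  finally show ?thesis .
qed

section \<open>Renewal times of the iterated rule\<close>

text \<open>Iterate the stopping rule from the start: \<open>renewal_weight n l\<close> is the conditional
  probability, given a path with increments beginning with \<open>l\<close>, that \<open>length l\<close> is
  the first renewal time which is at least \<open>n\<close>.\<close>

fun renewal_weight :: "nat \<Rightarrow> 'a list \<Rightarrow> real" where
  "renewal_weight 0 l = (if l = [] then 1 else 0)"
| "renewal_weight (Suc n) l =
     (\<Sum>i<min M (length l). q (take (Suc i) l) * renewal_weight (n - i) (drop (Suc i) l))"

lemma renewal_weight_nonneg: "0 \<le> renewal_weight n l"
  by (induction n l rule: renewal_weight.induct) (auto intro!: sum_nonneg mult_nonneg_nonneg q_nonneg)

text \<open>Induction on the threshold by conditioning on the first renewal: at the position reached
  there, \<open>F\<close> is expanded again with the threshold that remains. The first renewal time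
  from \<open>n\<close> on is 0 for \<open>n = 0\<close> and at most \<open>n + M - 1\<close>
  otherwise, hence the condition on \<open>K\<close>.\<close>

lemma renewal_expansion:
  assumes F: "\<And>s. s \<in> S \<Longrightarrow> stopped F s = F s" and s: "s \<in> S"
    and K: "if n = 0 then 1 \<le> K else n + M \<le> K"
  shows "F s = (\<Sum>k<K. \<integral>\<^sup>+l. ennreal (renewal_weight n l) * F (foldl act s l) \<partial>paths k)"
  using s K
proof (induction n arbitrary: s K rule: less_induct)
  case (less n)
  let ?W = "\<lambda>n l. ennreal (renewal_weight n l)"
  show ?case
  proof (cases n)
    case 0
    have "(\<integral>\<^sup>+l. ?W 0 l * F (foldl act s l) \<partial>paths k) = (if k = 0 then F s else 0)" for k
    proof (cases "k = 0")
      case True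
      then show ?thesis by (simp add: nn_integral_replicate_pmf_0 del: replicate_pmf.simps)
    next
      case False
      then have "(\<integral>\<^sup>+l. ?W 0 l * F (foldl act s l) \<partial>paths k) = (\<integral>\<^sup>+l. 0 \<partial>paths k)"
        by (intro nn_integral_pmf_cong) (auto simp: in_set_replicate_pmf)
      then show ?thesis using False by simp
    qed
    then show ?thesis using less.prems 0 by (simp add: sum.delta)
  next
    case (Suc n')
    let ?T = "\<lambda>i k. \<integral>\<^sup>+l. ennreal (q (take (Suc i) l)) * ?W (n' - i) (drop (Suc i) l) *
                 F (foldl act s l) \<partial>paths k"
    have K: "M \<le> K" using less.prems Suc by simp
    have step: "(\<integral>\<^sup>+xs. ennreal (q xs) * F (foldl act s xs) \<partial>paths (Suc i)) =
        (\<Sum>k\<in>{Suc i..<K}. ?T i k)" if i: "i < M" for i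
    proof -
      \<comment> \<open>The case \<open>n = 0\<close> of the bound matters here: with
        \<open>n' = 0\<close>, \<open>K = Suc M\<close> and \<open>i = M - 1\<close>, only the
        horizon 1 is left after the first jump.\<close>
      have C: "if n' - i = 0 then 1 \<le> K - Suc i else n' - i + M \<le> K - Suc i"
        using less.prems Suc i M_pos by auto
      have "(\<integral>\<^sup>+xs. ennreal (q xs) * F (foldl act s xs) \<partial>paths (Suc i)) =
        (\<integral>\<^sup>+xs. ennreal (q xs) * (\<Sum>k<K - Suc i. \<integral>\<^sup>+ys. ?W (n' - i) ys *
           F (foldl act (foldl act s xs) ys) \<partial>paths k) \<partial>paths (Suc i))"
      proof (intro nn_integral_pmf_cong arg_cong2[where f=times] refl)
        fix xs assume "xs \<in> set_pmf (paths (Suc i))"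
        then have "foldl act s xs \<in> S" 
          using less.prems by (simp add: foldl_closed in_set_replicate_pmf del: replicate_pmf.simps)
        from less.IH[OF _ this C]
        show "F (foldl act s xs) = (\<Sum>k<K - Suc i. \<integral>\<^sup>+ys. ?W (n' - i) ys *
           F (foldl act (foldl act s xs) ys) \<partial>paths k)" using Suc by simp
      qed
      also have "\<dots> = (\<Sum>k<K - Suc i. \<integral>\<^sup>+xs. \<integral>\<^sup>+ys. ennreal (q xs) * ?W (n' - i) ys *
           F (foldl act s (xs @ ys)) \<partial>paths k \<partial>paths (Suc i))"
        by (simp add: sum_distrib_left nn_integral_sum nn_integral_cmult[symmetric] mult.assoc
            del: replicate_pmf.simps)
      also have "\<dots> = (\<Sum>k<K - Suc i. ?T i (Suc i + k))"
        unfolding nn_integral_replicate_pmf_add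
        by (intro sum.cong refl nn_integral_pmf_cong)
          (simp add: in_set_replicate_pmf del: replicate_pmf.simps)
      also have "\<dots> = (\<Sum>k\<in>{Suc i..<K}. ?T i k)"
        by (rule sum.reindex_bij_witness[of _ "\<lambda>k. k - Suc i" "\<lambda>k. Suc i + k"]) auto
      finally show ?thesis .
    qed
    have "F s = (\<Sum>i<M. \<Sum>k\<in>{Suc i..<K}. ?T i k)"
      unfolding F[OF less.prems(1), symmetric] stopped_def by (intro sum.cong refl step) simp
    also have "\<dots> = (\<Sum>i<M. \<Sum>k | k < K \<and> i < k. ?T i k)"
      by (intro sum.cong refl) auto
    \<comment> \<open>The sum over the first jump is moved inside the sum over the total length; a
      first jump cannot exceed the total length, which gives the \<open>min\<close> of the recursion
      for \<open>renewal_weight\<close>.\<close>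
    also have "\<dots> = (\<Sum>k<K. \<Sum>i | i < M \<and> i < k. ?T i k)"
      using sum.swap_restrict[of "{..<M}" "{..<K}" ?T "\<lambda>i k. i < k"] by simp
    also have "\<dots> = (\<Sum>k<K. \<Sum>i<min M k. ?T i k)"
      by (intro sum.cong refl) auto
    also have "\<dots> = (\<Sum>k<K. \<integral>\<^sup>+l. ?W n l * F (foldl act s l) \<partial>paths k)"
    proof (intro sum.cong refl)
      fix k
      have "(\<Sum>i<min M k. ?T i k) = (\<integral>\<^sup>+l. (\<Sum>i<min M k. ennreal (q (take (Suc i) l)) *
          ?W (n' - i) (drop (Suc i) l) * F (foldl act s l)) \<partial>paths k)"
        by (simp add: nn_integral_sum)
      also have "\<dots> = (\<integral>\<^sup>+l. ?W n l * F (foldl act s l) \<partial>paths k)"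
        unfolding Suc
        by (intro nn_integral_pmf_cong)
          (simp add: in_set_replicate_pmf sum_distrib_right[symmetric] sum_ennreal[symmetric]
             q_nonneg renewal_weight_nonneg ennreal_mult)
      finally show "(\<Sum>i<min M k. ?T i k) = (\<integral>\<^sup>+l. ?W n l * F (foldl act s l) \<partial>paths k)" .
    qed
    finally show ?thesis .
  qed
qed

text \<open>On a fixed path the starting time \<open>i\<close> of the renewals is the variable,
  while the target time \<open>n\<close> stays put. The copies of \<open>x\<close> prolong the path
  so that the jump probabilities add up to 1 even near its end; the value 0 beyond
  \<open>length l\<close> removes the jumps that leave \<open>l\<close>.\<close>

lemma renewal_weight_forward_average:
  assumes l: "set l \<subseteq> set_pmf \<mu>" and x: "x \<in> set_pmf \<mu>"
  shows "forward_average M (\<lambda>i j. q (take (Suc j) (drop i (l @ replicate (n + M) x))))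
           (\<lambda>i. if i \<le> length l then renewal_weight (n - i) (drop i l) else 0) n"
  unfolding forward_average_def
proof (intro allI impI conjI)
  fix i j show "0 \<le> q (take (Suc j) (drop i (l @ replicate (n + M) x)))" by (rule q_nonneg)
next
  fix i assume i: "i < n"
  let ?p = "drop i (l @ replicate (n + M) x)"
  have p: "set (take M ?p) \<subseteq> set_pmf \<mu>" "length (take M ?p) = M"
    using l x i by (auto dest!: in_set_takeD in_set_dropD)
  have "(\<Sum>j<M. q (take (Suc j) ?p)) = (\<Sum>j<M. q (take (Suc j) (take M ?p)))"
    by (intro sum.cong refl) (simp only: take_take min_absorb1 Suc_leI lessThan_iff)
  then show "(\<Sum>j<M. q (take (Suc j) ?p)) = 1" using q_sum[OF p] by simp
  let ?\<phi> = "\<lambda>i. if i \<le> length l then renewal_weight (n - i) (drop i l) else 0"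
  show "?\<phi> i = (\<Sum>j<M. q (take (Suc j) ?p) * ?\<phi> (i + Suc j))"
  proof (cases "i \<le> length l")
    case False
    then show ?thesis by simp
  next
    case True
    have "n - i = Suc (n - Suc i)" using i by simp
    then have "?\<phi> i = (\<Sum>j<min M (length l - i).
        q (take (Suc j) (drop i l)) * renewal_weight (n - Suc i - j) (drop (Suc j) (drop i l)))"
      using True by simp
    also have "\<dots> = (\<Sum>j<M. q (take (Suc j) ?p) * ?\<phi> (i + Suc j))"
      using True by (intro sum.mono_neutral_cong_left) (auto simp: add_ac)
    finally show ?thesis .
  qed
qed

text \<open>The two weights are values of one averaging recursion at the starting times 0 and 1,
  with common target time \<open>Suc (m * M)\<close>. The contraction along \<open>m\<close> windows
  brings them together.\<close>

lemma renewal_weight_contraction: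
  assumes t: "0 \<le> t" "\<And>a. a \<in> set_pmf \<mu> \<Longrightarrow> t \<le> q [a]"
    and l: "set l \<subseteq> set_pmf \<mu>" "l \<noteq> []"
  shows "\<bar>renewal_weight (Suc (m * M)) l - renewal_weight (m * M) (tl l)\<bar> \<le> (1 - t ^ M) ^ m"
proof -
  obtain x where x: "x \<in> set_pmf \<mu>" using l by (cases l) auto
  define n where "n = Suc (m * M)"
  define \<phi> where "\<phi> i = (if i \<le> length l then renewal_weight (n - i) (drop i l) else 0)" for i
  define Q where "Q i j = q (take (Suc j) (drop i (l @ replicate (n + M) x)))" for i j
  have avg: "forward_average M Q \<phi> n"
    using renewal_weight_forward_average[OF l(1) x, of n] unfolding Q_def[abs_def] \<phi>_def[abs_def] .
  have tQ: "t \<le> Q i 0" if "i < n" for i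
  proof -
    have "drop i (l @ replicate (n + M) x) \<noteq> []"
      unfolding drop_eq_Nil using that by simp
    then obtain a as where as: "drop i (l @ replicate (n + M) x) = a # as"
      by (meson list.exhaust)
    have "a \<in> set (drop i (l @ replicate (n + M) x))" unfolding as by simp
    then have "a \<in> set_pmf \<mu>" using l x by (auto dest!: in_set_dropD)
    then show ?thesis using t as by (simp add: Q_def)
  qed
  \<comment> \<open>From \<open>n\<close> on, the remaining threshold is 0 and \<open>\<phi>\<close>
    is the indicator of the single index \<open>length l\<close>.\<close>
  have end_01: "0 \<le> \<phi> i \<and> \<phi> i \<le> 1" if "n \<le> i" for i using that by (simp add: \<phi>_def)
  have "0 \<le> \<phi> i \<and> \<phi> i \<le> 1" if "i < n + M" for i
  proof (cases "i < n")
    case True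
    have "t ^ M * (1 - \<phi> n) \<ge> 0" using t end_01[of n] by simp
    moreover have "\<phi> i \<le> 1 - t ^ M * (1 - \<phi> n)"
      using end_01 True by (intro forward_average_upper[OF avg t(1) tQ M_pos]) auto
    ultimately show ?thesis by (simp add: \<phi>_def renewal_weight_nonneg)
  qed (simp add: end_01)
  \<comment> \<open>The choice of \<open>n\<close> gives \<open>n - m * M + M = Suc M\<close>, so
    the final range contains both 0 and 1.\<close>
  from forward_average_contraction[OF avg t(1) tQ M_pos this, of m]
  obtain a where "\<And>i. i < Suc M \<Longrightarrow> a \<le> \<phi> i \<and> \<phi> i \<le> a + (1 - t ^ M) ^ m"
    by (auto simp: n_def)
  from this[of 0] this[of 1] M_pos have "\<bar>\<phi> 0 - \<phi> 1\<bar> \<le> (1 - t ^ M) ^ m" by (auto simp: abs_le_iff)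
  then show ?thesis using l(2) by (cases l) (simp_all add: \<phi>_def n_def)
qed

text \<open>With threshold \<open>length l\<close> the weight is the probability that this very time
  is a renewal. The boundary values are 1 at that time and 0 afterwards, so the lower bound with
  \<open>a = 0\<close> yields \<open>t ^ M\<close>.\<close>

lemma renewal_weight_lower:
  assumes t: "0 \<le> t" "t \<le> 1" "\<And>a. a \<in> set_pmf \<mu> \<Longrightarrow> t \<le> q [a]"
    and l: "set l \<subseteq> set_pmf \<mu>"
  shows "t ^ M \<le> renewal_weight (length l) l"
proof (cases "l = []")
  case True
  then show ?thesis using t by (simp add: power_le_one)
next
  case False
  then obtain x where x: "x \<in> set_pmf \<mu>" using l by (cases l) auto
  define n where "n = length l"
  define \<phi> where "\<phi> i = (if i \<le> length l then renewal_weight (n - i) (drop i l) else 0)" for i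
  define Q where "Q i j = q (take (Suc j) (drop i (l @ replicate (n + M) x)))" for i j
  have avg: "forward_average M Q \<phi> n"
    using renewal_weight_forward_average[OF l(1) x, of n] unfolding Q_def[abs_def] \<phi>_def[abs_def] .
  have tQ: "t \<le> Q i 0" if "i < n" for i
  proof -
    have "take 1 (drop i l) = [l ! i]" using that by (simp add: n_def take_Suc hd_drop_conv_nth)
    moreover have "l ! i \<in> set_pmf \<mu>" using l that by (auto simp: n_def)
    ultimately show ?thesis using t that by (simp add: Q_def n_def)
  qed
  have "0 + t ^ M * (\<phi> n - 0) \<le> \<phi> 0"
    using False by (intro forward_average_lower[OF avg t(1) tQ M_pos]) (auto simp: \<phi>_def n_def)
  then show ?thesis by (simp add: \<phi>_def n_def)
qed

text \<open>In the expansion with threshold \<open>n\<close>, the term of the paths of length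
  exactly \<open>n\<close> alone carries weight at least \<open>t ^ M\<close>. The resulting
  constant does not depend on \<open>n\<close>.\<close>

lemma harmonic_growth:
  assumes t: "0 < t" "t \<le> 1" "\<And>a. a \<in> set_pmf \<mu> \<Longrightarrow> t \<le> q [a]"
    and F: "\<And>s. s \<in> S \<Longrightarrow> stopped F s = F s" and s: "s \<in> S"
  shows "(\<integral>\<^sup>+l. F (foldl act s l) \<partial>paths n) \<le> ennreal (1 / t ^ M) * F s"
proof -
  let ?B = "\<integral>\<^sup>+l. F (foldl act s l) \<partial>paths n"
  have "ennreal (t ^ M) * ?B = (\<integral>\<^sup>+l. ennreal (t ^ M) * F (foldl act s l) \<partial>paths n)"
    by (simp add: nn_integral_cmult)
  also have "\<dots> \<le> (\<integral>\<^sup>+l. ennreal (renewal_weight n l) * F (foldl act s l) \<partial>paths n)"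
    using renewal_weight_lower[of t] t
    by (intro nn_integral_pmf_mono mult_right_mono ennreal_leI) (auto simp: in_set_replicate_pmf)
  also have "\<dots> \<le> (\<Sum>k<n + M. \<integral>\<^sup>+l. ennreal (renewal_weight n l) * F (foldl act s l) \<partial>paths k)"
    using M_pos by (intro member_le_sum) auto
  also have "\<dots> = F s"
    using M_pos by (intro renewal_expansion[OF F s, symmetric]) auto
  finally have "ennreal (1 / t ^ M) * (ennreal (t ^ M) * ?B) \<le> ennreal (1 / t ^ M) * F s"
    by (rule mult_left_mono) simp
  moreover have "ennreal (1 / t ^ M) * (ennreal (t ^ M) * ?B) = ?B"
    using t by (simp add: mult.assoc[symmetric] ennreal_mult[symmetric])
  ultimately show ?thesis by simp
qed

text \<open>Expanding at the same target time from time 0 and from time 1 writes both sides as sums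
  over the same paths, with nearly equal weights. The growth bound turns this into an error that is
  a real null sequence, as \<open>F s\<close> is finite.\<close>

theorem harmonic_if_stopped_eq:
  assumes t: "0 < t" "t \<le> 1" "\<And>a. a \<in> set_pmf \<mu> \<Longrightarrow> t \<le> q [a]"
    and F: "\<And>s. s \<in> S \<Longrightarrow> stopped F s = F s" and s: "s \<in> S"
    and fin: "F s < \<top>"
  shows "(\<integral>\<^sup>+a. F (act s a) \<partial>\<mu>) = F s"
proof -
  let ?PF = "\<integral>\<^sup>+a. F (act s a) \<partial>\<mu>"
  let ?B = "\<lambda>k. \<integral>\<^sup>+l. F (foldl act s l) \<partial>paths k"
  define \<rho> where "\<rho> = 1 - t ^ M"
  have \<rho>: "0 \<le> \<rho>" "\<rho> < 1" using t by (auto simp: \<rho>_def power_le_one)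
  \<comment> \<open>The number of path lengths, times the difference of the weights, times the
    growth bound for each length.\<close>
  define \<delta> where "\<delta> m = real (m * M + M + 1) * (\<rho> ^ m * (1 / t ^ M * enn2real (F s)))" for m
  have le: "F s \<le> ?PF + ennreal (\<delta> m) \<and> ?PF \<le> F s + ennreal (\<delta> m)" for m
  proof -
    define n where "n = m * M"
    define K where "K = m * M + M + 1"
    let ?A = "\<lambda>k. \<integral>\<^sup>+l. ennreal (renewal_weight (Suc n) l) * F (foldl act s l) \<partial>paths (Suc k)"
    let ?D = "\<lambda>k. \<integral>\<^sup>+l. ennreal (renewal_weight n (tl l)) * F (foldl act s l) \<partial>paths (Suc k)"
    have "F s = (\<Sum>k<Suc K. \<integral>\<^sup>+l. ennreal (renewal_weight (Suc n) l) * F (foldl act s l) \<partial>paths k)"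
      by (rule renewal_expansion[OF F s]) (auto simp: n_def K_def)
    \<comment> \<open>The empty path has weight 0 for a positive threshold, so only lengths
      \<open>Suc k\<close> remain.\<close>
    also have "\<dots> = (\<Sum>k<K. ?A k)"
      unfolding sum.lessThan_Suc_shift nn_integral_replicate_pmf_0 by simp
    finally have A: "F s = (\<Sum>k<K. ?A k)" .
    \<comment> \<open>After the first increment \<open>a\<close> the expansion has threshold
      \<open>n\<close>; in terms of the whole path its weight is that of the tail.\<close>
    have "?PF = (\<integral>\<^sup>+a. (\<Sum>k<K. \<integral>\<^sup>+l. ennreal (renewal_weight n l) * F (foldl act (act s a) l) \<partial>paths k) \<partial>\<mu>)"
      by (intro nn_integral_pmf_cong renewal_expansion[OF F act_closed[OF s]]) (auto simp: n_def K_def)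
    also have "\<dots> = (\<Sum>k<K. ?D k)"
      unfolding nn_integral_replicate_pmf_Suc by (simp add: nn_integral_sum)
    finally have D: "?PF = (\<Sum>k<K. ?D k)" .
    have *: "\<bar>renewal_weight (Suc n) l - renewal_weight n (tl l)\<bar> \<le> \<rho> ^ m"
      if "l \<in> set_pmf (paths (Suc k))" for l k
      unfolding \<rho>_def n_def
      using that t by (intro renewal_weight_contraction) (auto simp: in_set_replicate_pmf simp del: replicate_pmf.simps)
    have diffs: "renewal_weight (Suc n) l \<le> renewal_weight n (tl l) + \<rho> ^ m"
        "renewal_weight n (tl l) \<le> renewal_weight (Suc n) l + \<rho> ^ m"
      if "l \<in> set_pmf (paths (Suc k))" for l k
      using abs_le_D1[OF *[OF that]] abs_le_D2[OF *[OF that]] by linarith+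
    \<comment> \<open>One-sided, for arbitrary weights \<open>v\<close> and \<open>w\<close>: it is
      applied in both directions, which avoids subtraction in \<open>ennreal\<close>.\<close>
    have close: "(\<integral>\<^sup>+l. ennreal (v l) * F (foldl act s l) \<partial>paths (Suc k)) \<le>
        (\<integral>\<^sup>+l. ennreal (w l) * F (foldl act s l) \<partial>paths (Suc k)) + ennreal (\<rho> ^ m * (1 / t ^ M * enn2real (F s)))"
      if vw: "\<And>l. l \<in> set_pmf (paths (Suc k)) \<Longrightarrow> v l \<le> w l + \<rho> ^ m" and w: "\<And>l. 0 \<le> w l" for v w k
    proof -
      have "(\<integral>\<^sup>+l. ennreal (v l) * F (foldl act s l) \<partial>paths (Suc k)) \<le>
        (\<integral>\<^sup>+l. ennreal (w l) * F (foldl act s l) + ennreal (\<rho> ^ m) * F (foldl act s l) \<partial>paths (Suc k))"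
        using vw w \<rho>
        by (intro nn_integral_pmf_mono)
          (auto simp: distrib_right[symmetric] ennreal_plus[symmetric] intro!: mult_right_mono ennreal_leI
             simp del: ennreal_plus replicate_pmf.simps)
      also have "\<dots> = (\<integral>\<^sup>+l. ennreal (w l) * F (foldl act s l) \<partial>paths (Suc k)) + ennreal (\<rho> ^ m) * ?B (Suc k)"
        by (simp add: nn_integral_add nn_integral_cmult del: replicate_pmf.simps)
      also have "ennreal (\<rho> ^ m) * ?B (Suc k) \<le> ennreal (\<rho> ^ m) * (ennreal (1 / t ^ M) * F s)"
        by (intro mult_left_mono harmonic_growth[OF t F s]) simp_all
      also have "ennreal (\<rho> ^ m) * (ennreal (1 / t ^ M) * F s) = ennreal (\<rho> ^ m * (1 / t ^ M * enn2real (F s)))"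
        using fin t \<rho> by (simp only: ennreal_mult ennreal_enn2real enn2real_nonneg zero_le_power
            zero_le_divide_1_iff less_imp_le mult_nonneg_nonneg)
      finally show ?thesis by (simp add: add_left_mono del: replicate_pmf.simps)
    qed
    have const: "(\<Sum>k<K. ennreal (\<rho> ^ m * (1 / t ^ M * enn2real (F s)))) = ennreal (\<delta> m)"
      using \<rho> t by (subst sum_ennreal) (auto simp: \<delta>_def K_def)
    have "(\<Sum>k<K. ?A k) \<le> (\<Sum>k<K. ?D k + ennreal (\<rho> ^ m * (1 / t ^ M * enn2real (F s))))"
      by (intro sum_mono close renewal_weight_nonneg diffs(1))
    moreover have "(\<Sum>k<K. ?D k) \<le> (\<Sum>k<K. ?A k + ennreal (\<rho> ^ m * (1 / t ^ M * enn2real (F s))))"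
      by (intro sum_mono close renewal_weight_nonneg diffs(2))
    ultimately show ?thesis unfolding sum.distrib const A[symmetric] D[symmetric] by simp
  qed
  have "(\<lambda>m. (real M * (real m * \<rho> ^ m) + (real M + 1) * \<rho> ^ m) * (1 / t ^ M * enn2real (F s)))
      \<longlonglongrightarrow> (real M * 0 + (real M + 1) * 0) * (1 / t ^ M * enn2real (F s))"
    using \<rho> by (intro tendsto_intros powser_times_n_limit_0 LIMSEQ_power_zero) auto
  moreover have "\<delta> = (\<lambda>m. (real M * (real m * \<rho> ^ m) + (real M + 1) * \<rho> ^ m) * (1 / t ^ M * enn2real (F s)))"
    by (auto simp: \<delta>_def fun_eq_iff algebra_simps add_divide_distrib)
  ultimately have "\<delta> \<longlonglongrightarrow> 0" by simp
  have small: "\<exists>m. \<delta> m \<le> e" if "0 < e" for e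
  proof -
    have "eventually (\<lambda>m. \<delta> m < e) sequentially" using \<open>\<delta> \<longlonglongrightarrow> 0\<close> that by (rule order_tendstoD(2))
    then show ?thesis by (meson eventually_sequentially less_imp_le order_refl)
  qed
  show ?thesis
  proof (rule antisym; rule ennreal_le_epsilon)
    fix e :: real assume "0 < e"
    then obtain m where "ennreal (\<delta> m) \<le> ennreal e" using small by (blast intro: ennreal_leI)
    then have "x + ennreal (\<delta> m) \<le> x + ennreal e" for x by (rule add_left_mono)
    then show "?PF \<le> F s + ennreal e" "F s \<le> ?PF + ennreal e"
      using le[of m] by (auto intro: order_trans)
  qed
qed

end

section \<open>Cylinders and the transformed measure\<close>

lemma emeasure_replicate_pmf_singleton:
  "emeasure (replicate_pmf (length l) p) {l} = (\<Prod>i<length l. emeasure p {l ! i})"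
proof (induction l)
  case Nil
  then show ?case by (simp add: emeasure_pmf_single)
next
  case (Cons a l)
  have "emeasure (replicate_pmf (length (a # l)) p) {a # l} =
      (\<integral>\<^sup>+l'. indicator {a # l} l' \<partial>replicate_pmf (Suc (length l)) p)"
    by (simp del: replicate_pmf.simps)
  also have "\<dots> = (\<integral>\<^sup>+x. \<integral>\<^sup>+xs. indicator {a} x * indicator {l} xs \<partial>replicate_pmf (length l) p \<partial>p)"
    unfolding nn_integral_replicate_pmf_Suc by (simp add: indicator_def of_bool_conj[symmetric])
  also have "\<dots> = emeasure p {a} * emeasure (replicate_pmf (length l) p) {l}"
    by (simp add: nn_integral_cmult nn_integral_multc)
  finally show ?case unfolding Cons.IH by (simp add: prod.lessThan_Suc_shift del: replicate_pmf.simps prod.lessThan_Suc)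
qed

lemma (in group) foldl_mult_closed:
  "g \<in> carrier G \<Longrightarrow> set l \<subseteq> carrier G \<Longrightarrow> foldl (\<otimes>) g l \<in> carrier G"
  by (induction l arbitrary: g) auto

lemma (in group) foldl_mult:
  assumes "g \<in> carrier G" "set l \<subseteq> carrier G"
  shows "foldl (\<otimes>) g l = g \<otimes> foldl (\<otimes>) \<one> l"
proof -
  have "foldl (\<otimes>) (g \<otimes> h) l = g \<otimes> foldl (\<otimes>) h l" if "h \<in> carrier G" for h
    using that assms by (induction l arbitrary: h) (auto simp: m_assoc)
  from this[of \<one>] show ?thesis using assms by simp
qed

lemma (in group) semigroup_span_foldl:
  assumes A: "A \<subseteq> carrier G" and g: "g \<in> semigroup_span G A"
  shows "\<exists>l\<in>lists A. g = foldl (\<otimes>) \<one> l"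
  using g
proof induction
  case (incl g)
  then show ?case using A by (intro bexI[of _ "[g]"]) auto
next
  case (mult g h)
  then obtain k l where kl: "k \<in> lists A" "l \<in> lists A" "g = foldl (\<otimes>) \<one> k" "h = foldl (\<otimes>) \<one> l"
    by blast
  have "set k \<subseteq> carrier G" "set l \<subseteq> carrier G" using kl(1,2) A by auto
  then have "g \<otimes> h = foldl (\<otimes>) \<one> (k @ l)"
    using foldl_mult[of "foldl (\<otimes>) \<one> k" l] kl by (simp add: foldl_mult_closed)
  then show ?case using kl by (intro bexI[of _ "k @ l"]) auto
qed

text \<open>Applied to the support of a generating measure, this makes the group countable.\<close>

lemma (in group) countable_semigroup_span:
  assumes "A \<subseteq> carrier G" "countable A"
  shows "countable (semigroup_span G A)"
proof (rule countable_subset)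
  show "semigroup_span G A \<subseteq> foldl (\<otimes>) \<one> ` lists A"
    using semigroup_span_foldl[OF assms(1)] by blast
  show "countable (foldl (\<otimes>) \<one> ` lists A)" using assms by auto
qed

section \<open>Paths and their histories\<close>

lemma walk_eq_foldl: "walk G h n = foldl (mult G) (one G) (map h [0..<n])"
  by (induction n) auto

lemma space_path_space:
  "space (path_space G) = {x. x 0 = one G \<and> (\<forall>n>0. x n \<in> carrier G)}"
  unfolding path_space_def space_PiM by (auto simp: PiE_def Pi_def split: if_splits)

text \<open>The property of not separating paths that agree up to time \<open>s\<close> holds for
  the generators and survives complements and countable unions. It makes the stopping condition
  usable on finite prefixes.\<close>

lemma path_history_cong:
  assumes "A \<in> path_history G s" "x \<in> space (path_space G)" "y \<in> space (path_space G)"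
    and "\<And>i. i \<le> s \<Longrightarrow> x i = y i"
  shows "x \<in> A \<longleftrightarrow> y \<in> A"
  using assms(1) unfolding path_history_def
proof induction
  case (Basic a)
  then show ?case using assms(2-4) by auto
qed (use assms(2-3) in auto)

section \<open>Harmonicity in terms of nonnegative integrals\<close>

lemma has_sum_iff_nn_integral:
  fixes u :: "'a \<Rightarrow> real"
  assumes "\<And>x. x \<in> A \<Longrightarrow> 0 \<le> u x" "0 \<le> c"
  shows "(\<lambda>x. \<bar>u x\<bar>) summable_on A \<and> (u has_sum c) A \<longleftrightarrow>
    (\<integral>\<^sup>+x. ennreal (u x) \<partial>count_space A) = ennreal c"
proof
  assume *: "(\<lambda>x. \<bar>u x\<bar>) summable_on A \<and> (u has_sum c) A"
  then have abs: "Infinite_Set_Sum.abs_summable_on u A"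
    using abs_summable_equivalent[of u A] by simp
  have "infsetsum u A = c" using infsetsum_infsum[OF abs] * infsumI by metis
  then show "(\<integral>\<^sup>+x. ennreal (u x) \<partial>count_space A) = ennreal c"
    using nn_integral_conv_infsetsum[OF abs assms(1)] by simp
next
  assume *: "(\<integral>\<^sup>+x. ennreal (u x) \<partial>count_space A) = ennreal c"
  have "integrable (count_space A) u"
    using * assms(1) by (intro integrableI_nonneg) (auto simp: AE_count_space)
  then have abs: "Infinite_Set_Sum.abs_summable_on u A"
    by (simp add: Infinite_Set_Sum.abs_summable_on_def)
  then have sum: "(\<lambda>x. \<bar>u x\<bar>) summable_on A"
    using abs_summable_equivalent[of u A] by simp
  have "infsum u A = c"
    using infsetsum_infsum[OF abs] infsetsum_conv_nn_integral[of A u] assms * by simp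
  moreover have "u summable_on A" using sum assms(1) by (metis (no_types, lifting) abs_of_nonneg summable_on_cong)
  ultimately show "(\<lambda>x. \<bar>u x\<bar>) summable_on A \<and> (u has_sum c) A"
    using sum by (metis has_sum_infsum)
qed

text \<open>For nonnegative terms, absolute convergence and the value of the sum amount to one
  equation in \<open>ennreal\<close>; the finite right-hand side accounts for the
  convergence.\<close>

lemma positive_harmonic_iff:
  assumes "\<And>h. h \<in> carrier G \<Longrightarrow> 0 \<le> \<theta> h" "group G"
  shows "f \<in> positive_harmonic G \<theta> \<longleftrightarrow> f \<in> carrier G \<rightarrow>\<^sub>E {0..} \<and>
    (\<forall>g\<in>carrier G. (\<integral>\<^sup>+h. ennreal (f (g \<otimes>\<^bsub>G\<^esub> h)) * ennreal (\<theta> h) \<partial>count_space (carrier G)) = ennreal (f g))"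
proof (cases "f \<in> carrier G \<rightarrow>\<^sub>E {0..}")
  case True
  interpret group G by fact
  have pos: "0 \<le> f h" if "h \<in> carrier G" for h using True that by (auto simp: PiE_def Pi_def)
  have "((\<lambda>h. \<bar>f (g \<otimes>\<^bsub>G\<^esub> h) * \<theta> h\<bar>) summable_on carrier G \<and>
        ((\<lambda>h. f (g \<otimes>\<^bsub>G\<^esub> h) * \<theta> h) has_sum f g) (carrier G)) \<longleftrightarrow>
      (\<integral>\<^sup>+h. ennreal (f (g \<otimes>\<^bsub>G\<^esub> h)) * ennreal (\<theta> h) \<partial>count_space (carrier G)) = ennreal (f g)"
    if g: "g \<in> carrier G" for g
  proof -
    have "(\<integral>\<^sup>+h. ennreal (f (g \<otimes>\<^bsub>G\<^esub> h) * \<theta> h) \<partial>count_space (carrier G)) =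
        (\<integral>\<^sup>+h. ennreal (f (g \<otimes>\<^bsub>G\<^esub> h)) * ennreal (\<theta> h) \<partial>count_space (carrier G))"
      using g pos assms(1) by (intro nn_integral_cong ennreal_mult) auto
    moreover have "0 \<le> f (g \<otimes>\<^bsub>G\<^esub> h) * \<theta> h" if "h \<in> carrier G" for h
      using g pos assms(1) that by simp
    ultimately show ?thesis
      using has_sum_iff_nn_integral[of "carrier G" "\<lambda>h. f (g \<otimes>\<^bsub>G\<^esub> h) * \<theta> h" "f g"] pos g by simp
  qed
  then show ?thesis using True by (simp add: positive_harmonic_def harmonic_def)
qed (simp add: positive_harmonic_def)

lemma transformed_mass_nonneg: "0 \<le> transformed_mass G \<mu> \<Lambda> \<tau> g"
  by (simp add: transformed_mass_def)

locale bounded_randomized_walk = group G + \<Lambda>: prob_space \<Lambda>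
  for G :: "('a, 'b) monoid_scheme" (structure) and \<Lambda> :: "'w measure" +
  fixes \<mu> :: "'a pmf" and \<tau> :: "(nat \<Rightarrow> 'a) \<times> 'w \<Rightarrow> enat" and M :: nat
  assumes supp: "set_pmf \<mu> \<subseteq> carrier G"
    and gen: "generating G \<mu>"
    and stopping: "randomized_stopping_time G \<Lambda> \<tau>"
    and bounded: "z \<in> space (path_space G \<Otimes>\<^sub>M \<Lambda>) \<Longrightarrow> \<tau> z \<le> enat M"
begin

section \<open>The law of finitely many increments\<close>

abbreviation increments :: "(nat \<Rightarrow> 'a) measure" where
  "increments \<equiv> Pi\<^sub>M UNIV (\<lambda>_. restrict_space (measure_pmf \<mu>) (carrier G))"

lemma countable_carrier: "countable (carrier G)"
  using countable_semigroup_span[OF supp] gen by (simp add: generating_def)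

lemma prob_space_restrict: "prob_space (restrict_space (measure_pmf \<mu>) (carrier G))"
proof
  have "emeasure \<mu> (carrier G) = 1"
    using supp by (simp add: measure_pmf.emeasure_eq_1_AE AE_measure_pmf_iff subset_iff)
  then show "emeasure (restrict_space (measure_pmf \<mu>) (carrier G))
      (space (restrict_space (measure_pmf \<mu>) (carrier G))) = 1"
    by (simp add: space_restrict_space emeasure_restrict_space)
qed

sublocale increments: product_prob_space "\<lambda>_. restrict_space (measure_pmf \<mu>) (carrier G)" UNIV
  by (simp add: product_prob_space_def product_sigma_finite_def product_prob_space_axioms_def
      prob_space_restrict prob_space_imp_sigma_finite)

lemma space_increments: "space increments = {h. \<forall>n. h n \<in> carrier G}"
  by (auto simp: space_PiM space_restrict_space)

lemma cylinder:
  assumes "l \<in> lists (carrier G)"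
  shows "(\<lambda>h. map h [0..<length l]) -` {l} \<inter> space increments =
      {h \<in> space increments. \<forall>i\<in>{..<length l}. h i \<in> {l ! i}}"
    and "{h \<in> space increments. \<forall>i\<in>{..<length l}. h i \<in> {l ! i}} \<in> sets increments"
proof -
  show "(\<lambda>h. map h [0..<length l]) -` {l} \<inter> space increments =
      {h \<in> space increments. \<forall>i\<in>{..<length l}. h i \<in> {l ! i}}"
  proof -
    have "map h [0..<length l] = l \<longleftrightarrow> (\<forall>i\<in>{..<length l}. h i \<in> {l ! i})" for h
      by (auto simp: list_eq_iff_nth_eq[of "map h [0..<length l]" l])
    then show ?thesis by (simp only: vimage_def singleton_iff Int_def mem_Collect_eq conj_commute)
  qed
  have "{h \<in> space increments. h i \<in> {l ! i}} \<in> sets increments" if "i \<in> {..<length l}" for i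
  proof (rule sets_Collect_single)
    have "l ! i \<in> carrier G" using assms nth_mem[of i l] that by blast
    then show "{l ! i} \<in> sets (restrict_space (measure_pmf \<mu>) (carrier G))"
      by (simp add: sets_restrict_space_iff)
  qed (rule UNIV_I)
  from sets.sets_Collect_finite_All[OF this finite_lessThan]
  show "{h \<in> space increments. \<forall>i\<in>{..<length l}. h i \<in> {l ! i}} \<in> sets increments"
    by (simp only: lessThan_iff)
qed

lemma measurable_prefix: "(\<lambda>h. map h [0..<n]) \<in> increments \<rightarrow>\<^sub>M count_space UNIV"
proof -
  let ?A = "{l \<in> lists (carrier G). length l = n}"
  have "countable ?A"
    by (rule countable_subset[OF _ countable_lists[OF countable_carrier]]) auto
  then have "(\<lambda>h. map h [0..<n]) \<in> increments \<rightarrow>\<^sub>M count_space ?A"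
    unfolding measurable_count_space_eq_countable[OF \<open>countable ?A\<close>]
  proof (intro conjI ballI funcsetI)
    fix h assume "h \<in> space increments"
    then show "map h [0..<n] \<in> ?A" by (auto simp: space_increments)
  next
    fix l assume "l \<in> ?A"
    then have l: "l \<in> lists (carrier G)" "n = length l" by auto
    show "(\<lambda>h. map h [0..<n]) -` {l} \<inter> space increments \<in> sets increments"
      unfolding l(2) cylinder(1)[OF l(1)] by (rule cylinder(2)[OF l(1)])
  qed
  then show ?thesis by (rule measurable_compose[where g="\<lambda>l. l"]) simp
qed

text \<open>Both measures live on the countable set of words of length \<open>n\<close> over the
  carrier and agree on single words. This is the passage from the infinite product to lists.\<close>

lemma distr_prefix:
  "distr increments (count_space UNIV) (\<lambda>h. map h [0..<n]) = measure_pmf (replicate_pmf n \<mu>)"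
proof (rule measure_eqI_countable_AE)
  let ?A = "{l \<in> lists (carrier G). length l = n}"
  show "countable ?A"
    by (rule countable_subset[OF _ countable_lists[OF countable_carrier]]) auto
  show "AE l in distr increments (count_space UNIV) (\<lambda>h. map h [0..<n]). l \<in> ?A"
    by (subst AE_distr_iff[OF measurable_prefix])
      (auto simp: space_increments intro!: AE_I2)
  show "AE l in replicate_pmf n \<mu>. l \<in> ?A"
    using supp by (fastforce simp: AE_measure_pmf_iff in_set_replicate_pmf)
  fix l assume l: "l \<in> ?A"
  then have n: "n = length l" and lists: "l \<in> lists (carrier G)" by auto
  have "emeasure (distr increments (count_space UNIV) (\<lambda>h. map h [0..<n])) {l} =
      emeasure increments {h \<in> space increments. \<forall>i\<in>{..<length l}. h i \<in> {l ! i}}"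
    using cylinder(1)[OF lists] measurable_prefix by (simp add: emeasure_distr n)
  also have "\<dots> = (\<Prod>i<length l. emeasure (restrict_space (measure_pmf \<mu>) (carrier G)) {l ! i})"
    using lists by (intro increments.emeasure_PiM_Collect) (auto simp: sets_restrict_space_iff)
  also have "\<dots> = (\<Prod>i<length l. emeasure \<mu> {l ! i})"
    using lists by (intro prod.cong refl emeasure_restrict_space) auto
  also have "\<dots> = emeasure (replicate_pmf n \<mu>) {l}"
    by (simp add: emeasure_replicate_pmf_singleton n)
  finally show "emeasure (distr increments (count_space UNIV) (\<lambda>h. map h [0..<n])) {l} =
    emeasure (replicate_pmf n \<mu>) {l}" .
qed simp_all

lemma nn_integral_prefix:
  "(\<integral>\<^sup>+h. f (map h [0..<n]) \<partial>increments) = (\<integral>\<^sup>+l. f l \<partial>replicate_pmf n \<mu>)"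
  unfolding distr_prefix[symmetric] by (rule nn_integral_distr[symmetric, OF measurable_prefix]) simp

lemma walk_in_space: "h \<in> space increments \<Longrightarrow> walk G h \<in> space (path_space G)"
  by (auto simp: space_path_space space_increments walk_eq_foldl intro!: foldl_mult_closed)

lemma measurable_walk: "walk G \<in> increments \<rightarrow>\<^sub>M path_space G"
  unfolding path_space_def
proof (rule measurable_PiM_single')
  show "walk G \<in> space increments \<rightarrow> (\<Pi>\<^sub>E i\<in>UNIV. space (count_space (if i = 0 then {\<one>} else carrier G)))"
    using walk_in_space by (auto simp: path_space_def space_PiM)
  fix n
  have prefix: "(\<lambda>h. walk G h n) \<in> increments \<rightarrow>\<^sub>M count_space UNIV"
    unfolding walk_eq_foldl by (rule measurable_compose[OF measurable_prefix]) simp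
  show "(\<lambda>h. walk G h n) \<in> increments \<rightarrow>\<^sub>M count_space (if n = 0 then {\<one>} else carrier G)"
  proof (rule measurableI)
    fix h assume "h \<in> space increments"
    then show "walk G h n \<in> space (count_space (if n = 0 then {\<one>} else carrier G))"
      using walk_in_space[of h] by (auto simp: space_path_space)
  next
    fix X show "(\<lambda>h. walk G h n) -` X \<inter> space increments \<in> sets increments"
      by (rule measurable_sets[OF prefix]) simp
  qed
qed

section \<open>Stopping probabilities conditional on the path\<close>

definition list_path :: "'a list \<Rightarrow> nat \<Rightarrow> 'a" where
  "list_path l i = foldl (\<otimes>) \<one> (take i l)"

text \<open>After time \<open>length l\<close> the path \<open>list_path l\<close> rests at its last
  position. For nonempty \<open>l\<close> any other continuation gives the same event, by the
  stopping property.\<close>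

definition stop_weight :: "'a list \<Rightarrow> real" where
  "stop_weight l = measure \<Lambda> {\<omega> \<in> space \<Lambda>. \<tau> (list_path l, \<omega>) = enat (length l)}"

lemma list_path_in_space: "set l \<subseteq> carrier G \<Longrightarrow> list_path l \<in> space (path_space G)"
  by (auto simp: space_path_space list_path_def intro!: foldl_mult_closed dest: in_set_takeD)

lemma stopping_cong:
  assumes "x \<in> space (path_space G)" "y \<in> space (path_space G)" "\<omega> \<in> space \<Lambda>" "1 \<le> s"
    and "\<And>i. i \<le> s \<Longrightarrow> x i = y i"
  shows "\<tau> (x, \<omega>) = enat s \<longleftrightarrow> \<tau> (y, \<omega>) = enat s"
proof -
  have "{x \<in> space (path_space G). \<tau> (x, \<omega>) = enat s} \<in> path_history G s"
    using stopping assms(3,4) by (auto simp: randomized_stopping_time_def path_stopping_time_def)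
  from path_history_cong[OF this assms(1,2,5)] show ?thesis using assms by simp
qed

lemma measurable_stopping [measurable]: "\<tau> \<in> path_space G \<Otimes>\<^sub>M \<Lambda> \<rightarrow>\<^sub>M count_space {1..}"
  using stopping by (simp add: randomized_stopping_time_def)

lemma stopping_event:
  assumes "x \<in> space (path_space G)"
  shows "{\<omega> \<in> space \<Lambda>. \<tau> (x, \<omega>) = c} \<in> sets \<Lambda>"
proof -
  have "(\<lambda>\<omega>. \<tau> (x, \<omega>)) \<in> \<Lambda> \<rightarrow>\<^sub>M count_space {1..}"
    using measurable_compose[OF measurable_Pair1'[OF assms] measurable_stopping] .
  then have "(\<lambda>\<omega>. \<tau> (x, \<omega>)) -` ({c} \<inter> {1..}) \<inter> space \<Lambda> \<in> sets \<Lambda>"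
    by (rule measurable_sets) auto
  moreover have "(\<lambda>\<omega>. \<tau> (x, \<omega>)) -` ({c} \<inter> {1..}) \<inter> space \<Lambda> = {\<omega> \<in> space \<Lambda>. \<tau> (x, \<omega>) = c}"
    using measurable_space[OF \<open>(\<lambda>\<omega>. \<tau> (x, \<omega>)) \<in> \<Lambda> \<rightarrow>\<^sub>M count_space {1..}\<close>] by auto
  ultimately show ?thesis by simp
qed

lemma stopping_range:
  assumes "x \<in> space (path_space G)" "\<omega> \<in> space \<Lambda>"
  obtains i where "i < M" "\<tau> (x, \<omega>) = enat (Suc i)"
proof -
  have "(x, \<omega>) \<in> space (path_space G \<Otimes>\<^sub>M \<Lambda>)" using assms by (simp add: space_pair_measure)
  from bounded[OF this] measurable_space[OF measurable_stopping this]
  have le: "\<tau> (x, \<omega>) \<le> enat M" "1 \<le> \<tau> (x, \<omega>)" by auto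
  then obtain k where k: "\<tau> (x, \<omega>) = enat k" by (cases "\<tau> (x, \<omega>)") auto
  then have "1 \<le> k" "k \<le> M" using le by (auto simp: one_enat_def)
  then show thesis using that[of "k - 1"] k by simp
qed

text \<open>Prefixes may be replaced by the full path, as both agree up to the time in question. For
  this single path the possible values of \<open>\<tau>\<close> partition
  \<open>space \<Lambda>\<close>.\<close>

lemma stop_weight_sum:
  assumes l: "set l \<subseteq> carrier G" "length l = M"
  shows "(\<Sum>i<M. stop_weight (take (Suc i) l)) = 1"
proof -
  let ?E = "\<lambda>i. {\<omega> \<in> space \<Lambda>. \<tau> (list_path l, \<omega>) = enat (Suc i)}"
  have "stop_weight (take (Suc i) l) = measure \<Lambda> (?E i)" if "i < M" for i
  proof -
    have len: "length (take (Suc i) l) = Suc i" using l that by simp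
    have sub: "set (take (Suc i) l) \<subseteq> carrier G" using l by (auto dest: in_set_takeD)
    have "\<tau> (list_path (take (Suc i) l), \<omega>) = enat (Suc i) \<longleftrightarrow> \<tau> (list_path l, \<omega>) = enat (Suc i)"
      if "\<omega> \<in> space \<Lambda>" for \<omega>
      using l sub that
      by (intro stopping_cong list_path_in_space) (auto simp: list_path_def min_def)
    then show ?thesis unfolding stop_weight_def len by (metis (mono_tags, lifting) Collect_cong)
  qed
  then have "(\<Sum>i<M. stop_weight (take (Suc i) l)) = (\<Sum>i<M. measure \<Lambda> (?E i))"
    by simp
  also have "\<dots> = measure \<Lambda> (\<Union>i<M. ?E i)"
    using l by (intro \<Lambda>.finite_measure_finite_Union[symmetric])
      (auto simp: disjoint_family_on_def intro!: stopping_event list_path_in_space)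
  also have "(\<Union>i<M. ?E i) = space \<Lambda>"
    using stopping_range[OF list_path_in_space[OF l(1)]] by blast
  finally show ?thesis by (simp add: \<Lambda>.prob_space)
qed

section \<open>The law of the stopped position\<close>

sublocale walk_law: prob_space "walk_law G \<mu>"
  unfolding walk_law_def by (rule increments.P.prob_space_distr[OF measurable_walk])

lemma sets_walk_law [measurable_cong]: "sets (walk_law G \<mu>) = sets (path_space G)"
  by (simp add: walk_law_def)

lemma space_walk_law: "space (walk_law G \<mu>) = space (path_space G)"
  by (simp add: walk_law_def)

lemma nn_integral_walk_law:
  "f \<in> borel_measurable (path_space G) \<Longrightarrow>
     (\<integral>\<^sup>+x. f x \<partial>walk_law G \<mu>) = (\<integral>\<^sup>+h. f (walk G h) \<partial>increments)"
  unfolding walk_law_def by (rule nn_integral_distr[OF measurable_walk]) simp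

text \<open>By Fubini the randomness in \<open>\<Lambda>\<close> is integrated first, for a fixed
  path. What remains depends on finitely many increments and is thus an integral over lists.\<close>

lemma transformed_mass_eq:
  "ennreal (transformed_mass G \<mu> \<Lambda> \<tau> g) =
     (\<Sum>i<M. \<integral>\<^sup>+l. ennreal (stop_weight l) * indicator {foldl (\<otimes>) \<one> l} g \<partial>replicate_pmf (Suc i) \<mu>)"
proof -
  interpret pair: pair_prob_space "walk_law G \<mu>" \<Lambda> ..
  let ?P = "walk_law G \<mu> \<Otimes>\<^sub>M \<Lambda>"
  let ?S = "{(x, \<omega>) \<in> space ?P. \<exists>n. \<tau> (x, \<omega>) = enat n \<and> x n = g}"
  have sets_P: "sets ?P = sets (path_space G \<Otimes>\<^sub>M \<Lambda>)"
    by (intro sets_pair_measure_cong sets_walk_law refl)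
  have \<tau>: "\<tau> \<in> ?P \<rightarrow>\<^sub>M count_space {1..}"
    using measurable_stopping measurable_cong_sets[OF sets_P refl] by blast
  \<comment> \<open>Here \<open>g\<close> may lie outside the carrier; cutting \<open>{g}\<close>
    down to the space of the \<open>n\<close>-th coordinate keeps the preimages measurable.\<close>
  have S: "?S \<in> sets ?P"
  proof -
    have "\<tau> -` ({enat n} \<inter> {1..}) \<inter> space ?P \<in> sets ?P" for n
      by (rule measurable_sets[OF \<tau>]) simp
    moreover have "(\<lambda>z. fst z n) -` ({g} \<inter> (if n = 0 then {\<one>} else carrier G)) \<inter> space ?P \<in> sets ?P" for n
    proof (rule measurable_sets)
      have "(\<lambda>x. x n) \<in> path_space G \<rightarrow>\<^sub>M count_space (if n = 0 then {\<one>} else carrier G)"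
        unfolding path_space_def by (rule measurable_component_singleton) simp
      then have "(\<lambda>x. x n) \<in> walk_law G \<mu> \<rightarrow>\<^sub>M count_space (if n = 0 then {\<one>} else carrier G)"
        using measurable_cong_sets[OF sets_walk_law refl] by blast
      then show "(\<lambda>z. fst z n) \<in> ?P \<rightarrow>\<^sub>M count_space (if n = 0 then {\<one>} else carrier G)"
        by (rule measurable_compose[OF measurable_fst])
    qed simp
    ultimately have "(\<Union>n. (\<tau> -` ({enat n} \<inter> {1..}) \<inter> space ?P) \<inter>
        ((\<lambda>z. fst z n) -` ({g} \<inter> (if n = 0 then {\<one>} else carrier G)) \<inter> space ?P)) \<in> sets ?P"
      by (intro sets.countable_UN' sets.Int) auto
    also have "(\<Union>n. (\<tau> -` ({enat n} \<inter> {1..}) \<inter> space ?P) \<inter>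
        ((\<lambda>z. fst z n) -` ({g} \<inter> (if n = 0 then {\<one>} else carrier G)) \<inter> space ?P)) = ?S"
    proof -
      have "\<tau> z \<in> {1..}" if "z \<in> space ?P" for z using measurable_space[OF \<tau> that] by simp
      moreover have "fst z n \<in> (if n = 0 then {\<one>} else carrier G)" if "z \<in> space ?P" for z n
        using that by (auto simp: space_pair_measure space_walk_law space_path_space)
      ultimately show ?thesis by (simp only: set_eq_iff vimage_def Int_iff UN_iff mem_Collect_eq
          singleton_iff UNIV_I bex_UNIV case_prod_unfold prod.collapse bex_simps) blast
    qed
    finally show ?thesis .
  qed
  have fiber: "emeasure \<Lambda> (Pair (walk G h) -` ?S) =
      (\<Sum>i<M. ennreal (stop_weight (map h [0..<Suc i])) *
         indicator {foldl (\<otimes>) \<one> (map h [0..<Suc i])} g)" if h: "h \<in> space increments" for h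
  proof -
    let ?E = "\<lambda>i. {\<omega> \<in> space \<Lambda>. \<tau> (walk G h, \<omega>) = enat (Suc i) \<and> walk G h (Suc i) = g}"
    have w: "walk G h \<in> space (path_space G)" by (rule walk_in_space[OF h])
    have E: "?E i \<in> sets \<Lambda>" for i
      using stopping_event[OF w, of "enat (Suc i)"] by (cases "walk G h (Suc i) = g") simp_all
    have weight: "emeasure \<Lambda> (?E i) = ennreal (stop_weight (map h [0..<Suc i])) *
        indicator {foldl (\<otimes>) \<one> (map h [0..<Suc i])} g" for i
    proof -
      have sub: "set (map h [0..<Suc i]) \<subseteq> carrier G" using h by (auto simp: space_increments)
      have "\<tau> (list_path (map h [0..<Suc i]), \<omega>) = enat (Suc i) \<longleftrightarrow> \<tau> (walk G h, \<omega>) = enat (Suc i)"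
        if "\<omega> \<in> space \<Lambda>" for \<omega>
        by (rule stopping_cong[OF list_path_in_space[OF sub] w that])
          (simp_all add: list_path_def walk_eq_foldl take_map take_upt del: upt_Suc)
      then have "{\<omega> \<in> space \<Lambda>. \<tau> (list_path (map h [0..<Suc i]), \<omega>) = enat (Suc i)} =
          {\<omega> \<in> space \<Lambda>. \<tau> (walk G h, \<omega>) = enat (Suc i)}"
        by blast
      then have "ennreal (stop_weight (map h [0..<Suc i])) =
          emeasure \<Lambda> {\<omega> \<in> space \<Lambda>. \<tau> (walk G h, \<omega>) = enat (Suc i)}"
        by (simp add: stop_weight_def \<Lambda>.emeasure_eq_measure del: upt_Suc)
      then show ?thesis
        unfolding walk_eq_foldl by (auto simp: indicator_def simp del: upt_Suc)
    qed
    have "Pair (walk G h) -` ?S = (\<Union>i<M. ?E i)"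
    proof (intro equalityI subsetI)
      fix \<omega> assume *: "\<omega> \<in> Pair (walk G h) -` ?S"
      then have "\<omega> \<in> space \<Lambda>" by (simp add: space_pair_measure)
      with stopping_range[OF w] obtain i where "i < M" "\<tau> (walk G h, \<omega>) = enat (Suc i)" by blast
      with * show "\<omega> \<in> (\<Union>i<M. ?E i)" by (auto simp: space_pair_measure)
    next
      fix \<omega> assume "\<omega> \<in> (\<Union>i<M. ?E i)"
      then show "\<omega> \<in> Pair (walk G h) -` ?S"
        using w by (auto simp: space_pair_measure space_walk_law simp del: walk.simps)
    qed
    moreover have "(\<Sum>i<M. emeasure \<Lambda> (?E i)) = emeasure \<Lambda> (\<Union>i<M. ?E i)"
      by (rule sum_emeasure) (use E in \<open>auto simp: disjoint_family_on_def simp del: walk.simps\<close>)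
    ultimately show ?thesis using weight by (simp only:)
  qed
  have "ennreal (transformed_mass G \<mu> \<Lambda> \<tau> g) = emeasure ?P ?S"
    unfolding transformed_mass_def by (rule pair.P.emeasure_eq_measure[symmetric])
  also have "\<dots> = (\<integral>\<^sup>+x. emeasure \<Lambda> (Pair x -` ?S) \<partial>walk_law G \<mu>)"
    by (rule \<Lambda>.emeasure_pair_measure_alt[OF S])
  also have "\<dots> = (\<integral>\<^sup>+h. emeasure \<Lambda> (Pair (walk G h) -` ?S) \<partial>increments)"
  proof -
    have "(\<lambda>x. emeasure \<Lambda> (Pair x -` ?S)) \<in> borel_measurable (walk_law G \<mu>)"
      by (rule \<Lambda>.measurable_emeasure_Pair[OF S])
    then have "(\<lambda>x. emeasure \<Lambda> (Pair x -` ?S)) \<in> borel_measurable (path_space G)"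
      using measurable_cong_sets[OF sets_walk_law refl] by blast
    then show ?thesis by (rule nn_integral_walk_law)
  qed
  also have "\<dots> = (\<integral>\<^sup>+h. (\<Sum>i<M. ennreal (stop_weight (map h [0..<Suc i])) *
         indicator {foldl (\<otimes>) \<one> (map h [0..<Suc i])} g) \<partial>increments)"
    by (rule nn_integral_cong[OF fiber])
  also have "\<dots> = (\<Sum>i<M. \<integral>\<^sup>+h. ennreal (stop_weight (map h [0..<Suc i])) *
         indicator {foldl (\<otimes>) \<one> (map h [0..<Suc i])} g \<partial>increments)"
    by (rule nn_integral_sum) (rule measurable_compose[OF measurable_prefix], simp)
  also have "\<dots> = (\<Sum>i<M. \<integral>\<^sup>+l. ennreal (stop_weight l) * indicator {foldl (\<otimes>) \<one> l} g
      \<partial>replicate_pmf (Suc i) \<mu>)"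
    by (intro sum.cong refl nn_integral_prefix)
  finally show ?thesis .
qed

text \<open>Tonelli on the countable group: summing over \<open>h\<close> first, the indicator
  selects the product of the word \<open>l\<close>.\<close>

lemma nn_integral_transformed_mass:
  assumes g: "g \<in> carrier G"
  shows "(\<integral>\<^sup>+h. F (g \<otimes> h) * ennreal (transformed_mass G \<mu> \<Lambda> \<tau> h) \<partial>count_space (carrier G)) =
    (\<Sum>i<M. \<integral>\<^sup>+l. ennreal (stop_weight l) * F (foldl (\<otimes>) g l) \<partial>replicate_pmf (Suc i) \<mu>)"
proof -
  let ?I = "\<lambda>h l. ennreal (stop_weight l) * (F (g \<otimes> h) * indicator {foldl (\<otimes>) \<one> l} h)"
  have "(\<integral>\<^sup>+h. F (g \<otimes> h) * ennreal (transformed_mass G \<mu> \<Lambda> \<tau> h) \<partial>count_space (carrier G)) =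
    (\<integral>\<^sup>+h. (\<Sum>i<M. \<integral>\<^sup>+l. ?I h l \<partial>replicate_pmf (Suc i) \<mu>) \<partial>count_space (carrier G))"
    unfolding transformed_mass_eq sum_distrib_left
    by (intro nn_integral_cong sum.cong refl)
      (simp add: nn_integral_cmult[symmetric] mult_ac del: replicate_pmf.simps)
  also have "\<dots> = (\<Sum>i<M. \<integral>\<^sup>+h. \<integral>\<^sup>+l. ?I h l \<partial>replicate_pmf (Suc i) \<mu> \<partial>count_space (carrier G))"
    by (rule nn_integral_sum) simp
  also have "\<dots> = (\<Sum>i<M. \<integral>\<^sup>+l. \<integral>\<^sup>+h. ?I h l \<partial>count_space (carrier G) \<partial>replicate_pmf (Suc i) \<mu>)"
    by (intro sum.cong refl nn_integral_count_space_nn_integral[symmetric] countable_carrier) simp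
  also have "\<dots> = (\<Sum>i<M. \<integral>\<^sup>+l. ennreal (stop_weight l) * F (foldl (\<otimes>) g l) \<partial>replicate_pmf (Suc i) \<mu>)"
  proof (intro sum.cong refl nn_integral_pmf_cong)
    fix i l assume "l \<in> set_pmf (replicate_pmf (Suc i) \<mu>)"
    then have l: "set l \<subseteq> carrier G" using supp by (auto simp: in_set_replicate_pmf simp del: replicate_pmf.simps)
    then have "foldl (\<otimes>) \<one> l \<in> carrier G" by (simp add: foldl_mult_closed)
    then have "(\<integral>\<^sup>+h. F (g \<otimes> h) * indicator {foldl (\<otimes>) \<one> l} h \<partial>count_space (carrier G)) =
        F (g \<otimes> foldl (\<otimes>) \<one> l)"
      by simp
    then show "(\<integral>\<^sup>+h. ?I h l \<partial>count_space (carrier G)) = ennreal (stop_weight l) * F (foldl (\<otimes>) g l)"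
      using foldl_mult[OF g l] by (simp add: nn_integral_cmult)
  qed
  finally show ?thesis .
qed

lemma nn_integral_step_mass:
  "(\<integral>\<^sup>+h. F (g \<otimes> h) * ennreal (pmf \<mu> h) \<partial>count_space (carrier G)) = (\<integral>\<^sup>+h. F (g \<otimes> h) \<partial>\<mu>)"
proof -
  have "pmf \<mu> h = 0" if "h \<notin> carrier G" for h using supp that by (auto simp: set_pmf_iff)
  then show ?thesis
    unfolding nn_integral_measure_pmf
    by (subst nn_integral_count_space_indicator)
      (auto intro!: nn_integral_cong simp: mult_ac split: split_indicator)
qed

section \<open>Harmonic functions\<close>

text \<open>The rule that stops at time 1 with probability \<open>t\<close> and follows
  \<open>\<tau>\<close> otherwise.\<close>

definition mixed_weight :: "real \<Rightarrow> 'a list \<Rightarrow> real" where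
  "mixed_weight t l = t * (if length l = 1 then 1 else 0) + (1 - t) * stop_weight l"

lemma stop_weight_nonneg: "0 \<le> stop_weight l"
  by (simp add: stop_weight_def)

lemma M_pos: "0 < M"
proof -
  obtain \<omega> where "\<omega> \<in> space \<Lambda>" using \<Lambda>.not_empty by blast
  then show ?thesis using stopping_range[OF list_path_in_space[of "[]"]] by force
qed

lemma stopped_walk_mixed:
  assumes t: "0 < t" "t \<le> 1"
  shows "stopped_walk \<mu> (\<otimes>) (carrier G) M (mixed_weight t)"
proof
  fix s a assume "s \<in> carrier G" "a \<in> set_pmf \<mu>"
  then show "s \<otimes> a \<in> carrier G" using supp by auto
next
  show "0 < M" by (rule M_pos)
next
  fix l show "0 \<le> mixed_weight t l" using t by (simp add: mixed_weight_def stop_weight_nonneg)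
next
  fix l assume l: "set l \<subseteq> set_pmf \<mu>" "length l = M"
  have "(\<Sum>i<M. (if length (take (Suc i) l) = 1 then 1 else 0)) = (\<Sum>i<M. if i = 0 then 1 else (0::real))"
    using l by (intro sum.cong) auto
  also have "\<dots> = 1" using M_pos by (simp add: sum.delta)
  finally show "(\<Sum>i<M. mixed_weight t (take (Suc i) l)) = 1"
    using l supp by (simp add: mixed_weight_def sum.distrib sum_distrib_left[symmetric] stop_weight_sum)
qed

text \<open>Both sides are affine in the rule, and stopping at time 1 contributes a single step of
  the walk. Harmonicity for the mixture thereby becomes invariance under
  \<open>stopped\<close>.\<close>

lemma nn_integral_mixed_mass:
  assumes t: "0 < t" "t \<le> 1" and g: "g \<in> carrier G"
  shows "(\<integral>\<^sup>+h. F (g \<otimes> h) * ennreal (t * pmf \<mu> h + (1 - t) * transformed_mass G \<mu> \<Lambda> \<tau> h)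
      \<partial>count_space (carrier G)) = stopped_walk.stopped \<mu> (\<otimes>) M (mixed_weight t) F g"
proof -
  interpret stopped_walk \<mu> "(\<otimes>)" "carrier G" M "mixed_weight t" by (rule stopped_walk_mixed[OF t])
  let ?P = "\<integral>\<^sup>+h. F (g \<otimes> h) \<partial>\<mu>"
  let ?Q = "\<Sum>i<M. \<integral>\<^sup>+l. ennreal (stop_weight l) * F (foldl (\<otimes>) g l) \<partial>paths (Suc i)"
  have split: "F (g \<otimes> h) * ennreal (t * pmf \<mu> h + (1 - t) * transformed_mass G \<mu> \<Lambda> \<tau> h) =
      ennreal t * (F (g \<otimes> h) * ennreal (pmf \<mu> h)) +
      ennreal (1 - t) * (F (g \<otimes> h) * ennreal (transformed_mass G \<mu> \<Lambda> \<tau> h))" for h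
    using t transformed_mass_nonneg[of G \<mu> \<Lambda> \<tau> h] by (simp add: ennreal_plus ennreal_mult distrib_left mult_ac)
  have first: "(\<integral>\<^sup>+l. ennreal (t * (if length l = 1 then 1 else 0)) * F (foldl (\<otimes>) g l) \<partial>paths (Suc i)) =
      (if i = 0 then ennreal t * ?P else 0)" for i
  proof (cases "i = 0")
    case True
    then show ?thesis
      by (simp only: nn_integral_replicate_pmf_Suc nn_integral_replicate_pmf_0) (simp add: nn_integral_cmult)
  next
    case False
    then have "(\<integral>\<^sup>+l. ennreal (t * (if length l = 1 then 1 else 0)) * F (foldl (\<otimes>) g l) \<partial>paths (Suc i)) =
       (\<integral>\<^sup>+l. 0 \<partial>paths (Suc i))"
      by (intro nn_integral_pmf_cong) (auto simp: in_set_replicate_pmf simp del: replicate_pmf.simps)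
    then show ?thesis using False by simp
  qed
  have "stopped F g = (\<Sum>i<M. (\<integral>\<^sup>+l. ennreal (t * (if length l = 1 then 1 else 0)) * F (foldl (\<otimes>) g l) +
      ennreal (1 - t) * (ennreal (stop_weight l) * F (foldl (\<otimes>) g l)) \<partial>paths (Suc i)))"
    unfolding stopped_def mixed_weight_def using t
    by (intro sum.cong refl nn_integral_cong)
      (simp add: ennreal_plus ennreal_mult stop_weight_nonneg distrib_left distrib_right mult_ac)
  also have "\<dots> = (\<Sum>i<M. if i = 0 then ennreal t * ?P else 0) + ennreal (1 - t) * ?Q"
    unfolding sum_distrib_left sum.distrib[symmetric] first[symmetric]
    by (intro sum.cong refl, subst nn_integral_add)
      (simp_all add: nn_integral_cmult del: replicate_pmf.simps)
  also have "(\<Sum>i<M. if i = 0 then ennreal t * ?P else 0) = ennreal t * ?P"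
    using M_pos by (simp add: sum.delta)
  finally have "stopped F g = ennreal t * ?P + ennreal (1 - t) * ?Q" .
  moreover have "(\<integral>\<^sup>+h. F (g \<otimes> h) * ennreal (t * pmf \<mu> h + (1 - t) * transformed_mass G \<mu> \<Lambda> \<tau> h)
      \<partial>count_space (carrier G)) = ennreal t * ?P + ennreal (1 - t) * ?Q"
    unfolding split nn_integral_step_mass[symmetric] nn_integral_transformed_mass[OF g, symmetric]
    by (simp add: nn_integral_add nn_integral_cmult)
  ultimately show ?thesis by simp
qed

theorem positive_harmonic_mixed:
  assumes t: "0 < t" "t \<le> 1"
  shows "positive_harmonic G (pmf \<mu>) =
    positive_harmonic G (\<lambda>g. t * pmf \<mu> g + (1 - t) * transformed_mass G \<mu> \<Lambda> \<tau> g)"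
proof (rule Set.set_eqI)
  fix f :: "'a \<Rightarrow> real"
  interpret stopped_walk \<mu> "(\<otimes>)" "carrier G" M "mixed_weight t" by (rule stopped_walk_mixed[OF t])
  let ?F = "\<lambda>g. ennreal (f g)"
  have \<mu>: "f \<in> positive_harmonic G (pmf \<mu>) \<longleftrightarrow> f \<in> carrier G \<rightarrow>\<^sub>E {0..} \<and>
      (\<forall>g\<in>carrier G. (\<integral>\<^sup>+h. ?F (g \<otimes> h) \<partial>\<mu>) = ?F g)"
    by (subst positive_harmonic_iff) (simp_all add: is_group nn_integral_step_mass[of ?F])
  have "f \<in> positive_harmonic G (\<lambda>g. t * pmf \<mu> g + (1 - t) * transformed_mass G \<mu> \<Lambda> \<tau> g) \<longleftrightarrow>
      f \<in> carrier G \<rightarrow>\<^sub>E {0..} \<and> (\<forall>g\<in>carrier G. stopped ?F g = ?F g)"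
    using t by (subst positive_harmonic_iff)
      (simp_all add: is_group transformed_mass_nonneg nn_integral_mixed_mass[OF t, of _ ?F] del: ennreal_plus)
  moreover have "(\<forall>g\<in>carrier G. (\<integral>\<^sup>+h. ?F (g \<otimes> h) \<partial>\<mu>) = ?F g) \<longleftrightarrow> (\<forall>g\<in>carrier G. stopped ?F g = ?F g)"
  proof
    assume "\<forall>g\<in>carrier G. (\<integral>\<^sup>+h. ?F (g \<otimes> h) \<partial>\<mu>) = ?F g"
    then show "\<forall>g\<in>carrier G. stopped ?F g = ?F g"
      by (intro ballI stopped_eq_if_harmonic) auto
  next
    assume *: "\<forall>g\<in>carrier G. stopped ?F g = ?F g"
    \<comment> \<open>The part of the rule that stops at time 1 supplies the lower bound on unit
      jumps required by the converse.\<close>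
    have "t \<le> mixed_weight t [a]" for a
      using t by (simp add: mixed_weight_def stop_weight_nonneg)
    with * show "\<forall>g\<in>carrier G. (\<integral>\<^sup>+h. ?F (g \<otimes> h) \<partial>\<mu>) = ?F g"
      by (intro ballI harmonic_if_stopped_eq[OF t]) auto
  qed
  ultimately show "f \<in> positive_harmonic G (pmf \<mu>) \<longleftrightarrow>
      f \<in> positive_harmonic G (\<lambda>g. t * pmf \<mu> g + (1 - t) * transformed_mass G \<mu> \<Lambda> \<tau> g)"
    using \<mu> by simp
qed

end

theorem theorem1:
  fixes G :: "('a, 'b) monoid_scheme"
    and \<mu> :: "'a pmf"
    and \<Lambda> :: "'w measure"
    and \<tau> :: "(nat \<Rightarrow> 'a) \<times> 'w \<Rightarrow> enat"
    and t :: real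
  assumes "group G"
    and "set_pmf \<mu> \<subseteq> carrier G"
    and "generating G \<mu>"
    and "prob_space \<Lambda>"
    and "randomized_stopping_time G \<Lambda> \<tau>"
    and "bounded_stopping_time G \<Lambda> \<tau>"
    and "0 < t" and "t \<le> 1"
  shows "positive_harmonic G (pmf \<mu>) =
    positive_harmonic G (\<lambda>g. t * pmf \<mu> g + (1 - t) * transformed_mass G \<mu> \<Lambda> \<tau> g)"
proof -
  obtain M where M: "\<And>z. z \<in> space (path_space G \<Otimes>\<^sub>M \<Lambda>) \<Longrightarrow> \<tau> z \<le> enat M"
    using assms(6) unfolding bounded_stopping_time_def by blast
  interpret bounded_randomized_walk G \<Lambda> \<mu> \<tau> M
    using assms M by (simp add: bounded_randomized_walk_def bounded_randomized_walk_axioms_def)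
  show ?thesis by (rule positive_harmonic_mixed[OF assms(7,8)])
qed

end
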